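(* A polynomial $f(t)$ is the warping polynomial $W_D(t)$ of some oriented knot diagram $D$ on $S^2$ if and only if either $f(t)=1$, or there exist integers $k\ge 0$, $l\ge 1$ and integers $m_0,m_1,\dots,m_{l-1}\ge 1$ with $m_0+m_1+\dots+m_{l-1}\ge k+l$ such that $$f(t)=m_0t^k+(m_0+m_1)t^{k+1}+(m_1+m_2)t^{k+2}+\dots+(m_{l-2}+m_{l-1})t^{k+l-1}+m_{l-1}t^{k+l}.$$ (For $l=1$ the formula reads $f(t)=m_0t^k+m_0t^{k+1}$.)
   Context: All knots and knot diagrams are oriented, and diagrams lie on $S^2$. A base point $b$ of a knot diagram $D$ is a point of $D$ that is not a crossing point. A crossing point of $D$ is a warping crossing point of $D_b=(D,b)$ if, going along $D$ following its orientation starting from $b$, one meets that crossing first as an under-crossing. The warping degree $d(D_b)$ is the number of warping crossing points of $D_b$. An edge of $D$ is a path on $D$ between (consecutive) crossing points with no crossings in its interior; for the diagram with no crossings, the whole circle counts as one edge. The warping degree $i(e)$ of an edge $e$ is $d(D_b)$ for any base point $b$ on $e$. The warping polynomial of $D$ is $W_D(t)=\sum_e t^{i(e)}$, the sum over all edges $e$ of $D$. In particular the diagram with no crossings has warping polynomial $1$. *)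

theory Defs
  imports "HOL-Analysis.Analysis" "HOL-Computational_Algebra.Polynomial"
begin

text \<open>
  A diagram is a generic \<open>C\<^sup>1\<close> immersion of the oriented circle into the unit sphere of
  \<open>\<real>\<^sup>3\<close>, with over/under information.  The circle is \<open>\<real>\<close> modulo \<open>1\<close>, so \<open>curve\<close> is periodic and
  \<open>{0..<1}\<close> meets every point of the circle exactly once; the orientation is the direction of
  increasing parameter.  \<open>over D t\<close> says that the strand passing at time \<open>t\<close> is the upper one; it
  is only meaningful when \<open>curve D t\<close> is a crossing.
\<close>

record diagram =
  curve :: "real \<Rightarrow> real ^ 3"
  over :: "real \<Rightarrow> bool"

definition crossings :: "diagram \<Rightarrow> (real ^ 3) set" where
  "crossings D =
     {p. \<exists>s\<in>{0..<1}. \<exists>t\<in>{0..<1}. s \<noteq> t \<and> curve D s = p \<and> curve D t = p}"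

text \<open>
  Transversality is phrased with \<open>span\<close>, since \<open>independent {v, w}\<close> would hold for \<open>v = w \<noteq> 0\<close>.
\<close>

definition knot_diagram :: "diagram \<Rightarrow> bool" where
  "knot_diagram D \<longleftrightarrow>
     range (curve D) \<subseteq> sphere 0 1 \<and>
     (\<forall>t. curve D (t + 1) = curve D t) \<and>
     curve D C1_differentiable_on UNIV \<and>
     (\<forall>t. vector_derivative (curve D) (at t) \<noteq> 0) \<and>
     finite (crossings D) \<and>
     (\<forall>s\<in>{0..<1}. \<forall>t\<in>{0..<1}. \<forall>u\<in>{0..<1}.
        curve D s = curve D t \<and> curve D t = curve D u \<longrightarrow> s = t \<or> t = u \<or> s = u) \<and>
     (\<forall>s\<in>{0..<1}. \<forall>t\<in>{0..<1}. s \<noteq> t \<and> curve D s = curve D t \<longrightarrow>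
        vector_derivative (curve D) (at s) \<notin> span {vector_derivative (curve D) (at t)}) \<and>
     (\<forall>t. over D (t + 1) = over D t) \<and>
     (\<forall>s\<in>{0..<1}. \<forall>t\<in>{0..<1}. s \<noteq> t \<and> curve D s = curve D t \<longrightarrow> over D s \<noteq> over D t)"

definition base_point :: "diagram \<Rightarrow> real ^ 3 \<Rightarrow> bool" where
  "base_point D b \<longleftrightarrow> b \<in> range (curve D) - crossings D"

text \<open>
  One turn around the diagram starting from \<open>b = curve D r\<close> is the parameter interval from \<open>r\<close> to
  \<open>r + 1\<close>; \<open>t\<close> is the first time at which \<open>p\<close> is met.
\<close>

definition warping_crossing :: "diagram \<Rightarrow> real ^ 3 \<Rightarrow> real ^ 3 \<Rightarrow> bool" where
  "warping_crossing D b p \<longleftrightarrow>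
     p \<in> crossings D \<and>
     (\<exists>r t. curve D r = b \<and> r < t \<and> t < r + 1 \<and> curve D t = p \<and>
            (\<forall>u. r < u \<and> u < t \<longrightarrow> curve D u \<noteq> p) \<and> \<not> over D t)"

definition warping_degree :: "diagram \<Rightarrow> real ^ 3 \<Rightarrow> nat" where
  "warping_degree D b = card {p. warping_crossing D b p}"

text \<open>
  Edges are represented as closed arcs, i.e. sets of points including the bounding crossings.
\<close>

definition edges :: "diagram \<Rightarrow> (real ^ 3) set set" where
  "edges D =
     (if crossings D = {} then {range (curve D)}
      else {curve D ` {a..b} | a b. a < b \<and> curve D a \<in> crossings D \<and> curve D b \<in> crossings D \<and>
              (\<forall>t. a < t \<and> t < b \<longrightarrow> curve D t \<notin> crossings D)})"

definition edge_warping_degree :: "diagram \<Rightarrow> (real ^ 3) set \<Rightarrow> nat" where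
  "edge_warping_degree D e =
     (THE i. \<forall>b\<in>e. base_point D b \<longrightarrow> warping_degree D b = i)"

definition warping_polynomial :: "diagram \<Rightarrow> int poly" where
  "warping_polynomial D = (\<Sum>e\<in>edges D. monom 1 (edge_warping_degree D e))"

end

theory Submission
  imports Defs
begin

text \<open>
  Let the base point travel once around a diagram.  Moving over an over-passage makes one more crossing a
  warping crossing, moving over an under-passage makes one less (\<open>degree_at_step\<close>).  So the warping
  degrees of the edges, in the order of the diagram, are the levels of a closed walk on the naturals with
  steps \<open>1\<close> and \<open>- 1\<close>, and the warping polynomial counts its arrivals at each level
  (\<open>warping_polynomial_walk\<close>).

  A closed walk goes up as often as down between two adjacent levels.  If \<open>k\<close> and \<open>k + l\<close> are its
  extreme levels and \<open>m\<^sub>i \<ge> 1\<close> is the number of its steps from \<open>k + i\<close> to \<open>k + i + 1\<close>, then it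
  arrives \<open>m\<^sub>i\<^sub>-\<^sub>1 + m\<^sub>i\<close> times at level \<open>k + i\<close>.  Each crossing is passed once from above, so the
  sum of the \<open>m\<^sub>i\<close> is the number of crossings, and no warping degree exceeds that number.  This
  proves that every warping polynomial has the stated form (\<open>closed_walk_poly\<close>).

  For the converse, diagrams are needed whose crossings are nested like brackets.  A kink, that is a small
  loop, contributes one step up and one step down between two adjacent levels.  If its crossing is passed
  first from above, it sits on an edge of the lower level and is no warping crossing; if it is passed first
  from below, it sits on an edge of the upper level and is a warping crossing.  Take \<open>l\<close> large loops,
  each around all later ones and passed first from above, and put \<open>m\<^sub>i - 1\<close> kinks at the \<open>i\<close>-th loop.
  This gives a walk with the prescribed \<open>m\<^sub>i\<close>, whose lowest level is the number of kinks that are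
  passed first from below.  That number can be any \<open>k\<close> up to the sum of the \<open>m\<^sub>i - 1\<close>, and
  \<open>k \<le> (\<Sum>i<l. m\<^sub>i) - l\<close> is the hypothesis of the theorem.

  To obtain these diagrams as immersed curves, arcs from \<open>0\<close> to \<open>1\<close> in a strip of the plane are built
  from a segment by two operations: putting one arc after another (\<open>realizable_append\<close>), and inserting
  an arc into the top of a fixed loop (\<open>realizable_wrap\<close>).  Both are similarities on the given arcs, so
  all double points are known explicitly.  Finally the strip is wrapped around the sphere
  (\<open>realizable_diagram\<close>).
\<close>

section \<open>Walks of warping degrees\<close>

text \<open>
  A list of passages is a word of Booleans, \<open>True\<close> for a passage on the upper strand.  Read from a start
  level \<open>d\<close>, it is a walk on the naturals.  The polynomial records the level reached after each step
  and not the start level: an edge begins where the base point has just gone through a crossing.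
\<close>

definition walk_step :: "bool \<Rightarrow> nat \<Rightarrow> nat" where
  "walk_step b d = (if b then d + 1 else d - 1)"

fun walk_end :: "nat \<Rightarrow> bool list \<Rightarrow> nat" where
  "walk_end d [] = d"
| "walk_end d (b # w) = walk_end (walk_step b d) w"

fun walk_poly :: "nat \<Rightarrow> bool list \<Rightarrow> int poly" where
  "walk_poly d [] = 0"
| "walk_poly d (b # w) = monom 1 (walk_step b d) + walk_poly (walk_step b d) w"

text \<open>
  The levels stay below \<open>C\<close>, and no step down starts at \<open>0\<close>, where \<open>d - 1\<close> would be truncated.
\<close>

fun walk_in :: "nat \<Rightarrow> nat \<Rightarrow> bool list \<Rightarrow> bool" where
  "walk_in C d [] \<longleftrightarrow> d \<le> C"
| "walk_in C d (b # w) \<longleftrightarrow> d \<le> C \<and> (b \<or> d > 0) \<and> walk_in C (walk_step b d) w"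

text \<open>
  The edges of the level graph are numbered by their lower end: \<open>ups j\<close> counts the steps from \<open>j\<close> to
  \<open>j + 1\<close>, and \<open>downs j\<close> the steps from \<open>j + 1\<close> to \<open>j\<close>.
\<close>

fun ups :: "nat \<Rightarrow> nat \<Rightarrow> bool list \<Rightarrow> nat" where
  "ups j d [] = 0"
| "ups j d (b # w) = (if b \<and> d = j then 1 else 0) + ups j (walk_step b d) w"

fun downs :: "nat \<Rightarrow> nat \<Rightarrow> bool list \<Rightarrow> nat" where
  "downs j d [] = 0"
| "downs j d (b # w) = (if \<not> b \<and> d = j + 1 then 1 else 0) + downs j (walk_step b d) w"

text \<open>
  Crossings of the gap between \<open>j\<close> and \<open>j + 1\<close> alternate in direction.  A closed walk therefore has
  as many steps up as down over each gap.
\<close>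

lemma ups_minus_downs:
  assumes "walk_in C d w"
  shows "int (ups j d w) - int (downs j d w) = of_bool (walk_end d w > j) - of_bool (d > j)"
  using assms
proof (induction w arbitrary: d)
  case (Cons b w)
  from Cons.prems have "walk_in C (walk_step b d) w" by simp
  from Cons.IH[OF this] Cons.prems show ?case by (cases b) (auto simp: walk_step_def of_bool_def split: if_splits)
qed simp

text \<open>
  Each visit that is counted at level \<open>n\<close> arrives from \<open>n - 1\<close> or from \<open>n + 1\<close>.
\<close>

lemma coeff_walk_poly:
  assumes "walk_in C d w"
  shows "coeff (walk_poly d w) n = int (if n = 0 then 0 else ups (n - 1) d w) + int (downs n d w)"
  using assms
proof (induction w arbitrary: d)
  case (Cons b w)
  then show ?case using Cons.IH[of "walk_step b d"] by (cases b) (auto simp: walk_step_def)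
qed simp

text \<open>
  A walk that never crosses the gap above \<open>c\<close> stays on the side where it starts.  This makes the levels
  visited an interval, which is why all \<open>m i\<close> are positive.
\<close>

lemma uncrossed_level:
  assumes "walk_in C d w" "ups c d w = 0" "downs c d w = 0"
  shows "(d \<le> c \<longrightarrow> c < j \<longrightarrow> ups j d w = 0) \<and> (c < d \<longrightarrow> j < c \<longrightarrow> ups j d w = 0)"
  using assms
proof (induction w arbitrary: d)
  case (Cons b w)
  then show ?case using Cons.IH[of "walk_step b d"] by (cases b) (auto simp: walk_step_def split: if_splits)
qed simp

lemma ups_above:
  assumes "walk_in C d w" "C \<le> j"
  shows "ups j d w = 0"
  using assms 
proof (induction w arbitrary: d)
  case (Cons b w)
  have "walk_in C (walk_step b d) w \<Longrightarrow> walk_step b d \<le> C" by (cases w) auto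
  with Cons show ?case by (auto simp: walk_step_def split: if_splits)
qed simp

lemma sum_ups:
  assumes "walk_in C d w"
  shows "(\<Sum>j<C. ups j d w) = count_list w True"
  using assms
proof (induction w arbitrary: d)
  case (Cons b w)
  have "walk_in C (walk_step b d) w \<Longrightarrow> walk_step b d \<le> C" by (cases w) auto
  with Cons show ?case by (auto simp: walk_step_def sum.distrib split: if_splits)
qed simp

lemma walk_end_count:
  assumes "walk_in C d w"
  shows "2 * int (count_list w True) = int (length w) + int (walk_end d w) - int d"
  using assms
proof (induction w arbitrary: d)
  case (Cons b w)
  then show ?case using Cons.IH[of "walk_step b d"] by (cases b) (auto simp: walk_step_def)
qed simp

text \<open>
  The right-hand side groups the terms by the gaps between levels: every step over the gap above
  \<open>k + i\<close> in either direction contributes one arrival, at \<open>k + i + 1\<close> or at \<open>k + i\<close>.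
\<close>

lemma level_polynomial_pairs:
  fixes m :: "nat \<Rightarrow> int"
  assumes "l \<ge> 1"
  shows "monom (m 0) k + (\<Sum>i=1..<l. monom (m (i - 1) + m i) (k + i)) + monom (m (l - 1)) (k + l)
     = (\<Sum>i<l. monom (m i) (k + i) + monom (m i) (k + i + 1))"
  using assms
proof (induction l rule: nat_induct_at_least)
  case base
  show ?case by simp
next
  case (Suc l)
  from Suc.hyps have "Suc (l - 1) = l" by simp
  then show ?case using Suc by (simp add: add_monom[symmetric] algebra_simps)
qed

lemma coeff_level_polynomial:
  fixes m :: "nat \<Rightarrow> int"
  shows "coeff (\<Sum>i<l. monom (m i) (k + i) + monom (m i) (k + i + 1)) n
    = (if k \<le> n \<and> n < k + l then m (n - k) else 0) + (if k < n \<and> n \<le> k + l then m (n - 1 - k) else 0)"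
  by (induction l) (auto simp: less_Suc_eq le_Suc_eq)

text \<open>
  For a closed walk, \<open>m i\<close> is the number of steps up over the gap above \<open>k + i\<close>, where \<open>k\<close> and
  \<open>k + l\<close> are the lowest and the highest level.  Half of the steps go up, so the \<open>m i\<close> add up to
  \<open>C\<close>; as no level exceeds \<open>C\<close>, this is at least \<open>k + l\<close>.
\<close>

lemma closed_walk_poly:
  assumes "walk_in C d w" "walk_end d w = d" "w \<noteq> []" "length w = 2 * C"
  shows "\<exists>k l (m :: nat \<Rightarrow> int). l \<ge> 1 \<and> (\<forall>i<l. m i \<ge> 1) \<and> (\<Sum>i<l. m i) \<ge> int k + int l \<and>
    walk_poly d w = (\<Sum>i<l. monom (m i) (k + i) + monom (m i) (k + i + 1))"
proof -
  have ud: "ups j d w = downs j d w" for j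
    using ups_minus_downs[OF assms(1), of j] assms(2) by simp
  define L where "L = {j. ups j d w > 0}"
  have Lsub: "L \<subseteq> {..<C}"
    using ups_above[OF assms(1)] by (fastforce simp: L_def not_less[symmetric])
  then have fin: "finite L" by (rule finite_subset) simp
  have tot: "(\<Sum>j<C. ups j d w) = C"
    using sum_ups[OF assms(1)] walk_end_count[OF assms(1)] assms(2,4) by simp
  have "C > 0" using assms(3,4) by (cases w) auto
  have "L \<noteq> {}"
  proof
    assume "L = {}"
    then have "(\<Sum>j<C. ups j d w) = 0" unfolding L_def by simp
    with tot \<open>C > 0\<close> show False by simp
  qed
  define k where "k = Min L"
  define l where "l = Max L - k + 1"
  define m where "m i = int (ups (k + i) d w)" for i
  have kL: "k \<in> L" and maxL: "Max L \<in> L" using fin \<open>L \<noteq> {}\<close> by (auto simp: k_def)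
  have kM: "k \<le> Max L" using fin \<open>L \<noteq> {}\<close> kL by simp
  have MC: "Max L < C" using Lsub maxL by blast
  \<comment> \<open>A gap between the extreme ones that is not crossed would separate them.\<close>
  have between: "c \<in> L" if "k \<le> c" "c \<le> Max L" for c
  proof (rule ccontr)
    assume "c \<notin> L"
    then have "ups c d w = 0" unfolding L_def by simp
    then have "downs c d w = 0" using ud[of c] by simp
    note flat = uncrossed_level[OF assms(1) \<open>ups c d w = 0\<close> this]
    have "k < c" "c < Max L" using that \<open>c \<notin> L\<close> kL maxL by (auto simp: less_le)
    then have "ups k d w = 0 \<or> ups (Max L) d w = 0" using flat[of k] flat[of "Max L"] by auto
    then show False using kL maxL unfolding L_def by simp
  qed
  have outside: "ups j d w = 0" if "j < k \<or> Max L < j" for j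
  proof -
    have "j \<notin> L" using that Min_le[OF fin, of j] Max_ge[OF fin, of j] unfolding k_def by linarith
    then show ?thesis by (simp add: L_def)
  qed
  have "(\<Sum>j<C. ups j d w) = (\<Sum>j\<in>{k..<k + l}. ups j d w)"
  proof (rule sum.mono_neutral_right)
    show "{k..<k + l} \<subseteq> {..<C}" using MC kM by (auto simp: l_def)
    show "\<forall>i\<in>{..<C} - {k..<k + l}. ups i d w = 0"
      using outside kM by (auto simp: l_def)
  qed simp
  also have "\<dots> = (\<Sum>i<l. ups (k + i) d w)"
    by (rule sum.reindex_bij_witness[of _ "\<lambda>i. k + i" "\<lambda>j. j - k"]) auto
  finally have "(\<Sum>i<l. m i) = int C" using tot unfolding m_def by simp
  moreover have "k + l \<le> C" using MC kM by (simp add: l_def)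
  moreover have "\<forall>i<l. m i \<ge> 1"
  proof (intro allI impI)
    fix i assume "i < l"
    then have "k + i \<in> L" using kM by (intro between) (auto simp: l_def)
    then show "m i \<ge> 1" unfolding L_def m_def by simp
  qed
  moreover have "walk_poly d w = (\<Sum>i<l. monom (m i) (k + i) + monom (m i) (k + i + 1))"
  proof (rule poly_eqI)
    fix n
    have "int (ups n d w) = (if k \<le> n \<and> n < k + l then m (n - k) else 0)"
      using outside[of n] kM by (auto simp: m_def l_def)
    moreover have "int (if n = 0 then 0 else ups (n - 1) d w)
       = (if k < n \<and> n \<le> k + l then m (n - 1 - k) else 0)"
    proof -
      have "ups (n - 1) d w = 0" if "n \<noteq> 0" "\<not> (k < n \<and> n \<le> k + l)"
        by (rule outside) (use that kM in \<open>auto simp: l_def\<close>)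
      then show ?thesis by (auto simp: m_def)
    qed
    ultimately show "coeff (walk_poly d w) n =
        coeff (\<Sum>i<l. monom (m i) (k + i) + monom (m i) (k + i + 1)) n"
      unfolding coeff_walk_poly[OF assms(1)] coeff_level_polynomial by (simp add: ud)
  qed
  moreover have "l \<ge> 1" by (simp add: l_def)
  ultimately show ?thesis by (intro exI[of _ k] exI[of _ l] exI[of _ m]) auto
qed

lemma walk_poly_append: "walk_poly d (u @ v) = walk_poly d u + walk_poly (walk_end d u) v"
  by (induction u arbitrary: d) (auto simp: algebra_simps)

lemma walk_end_append: "walk_end d (u @ v) = walk_end (walk_end d u) v"
  by (induction u arbitrary: d) auto

section \<open>Words of nested loops\<close>

text \<open>
  \<open>kinks b n\<close> is the word of \<open>n\<close> consecutive small loops, each with its crossing passed first on the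
  strand \<open>b\<close>.  In \<open>nest\<close>, each entry \<open>(p, q)\<close> gives a loop around all that comes later, with \<open>p\<close> kinks
  before its first passage and \<open>q\<close> kinks of the opposite kind just after it.  Both kinds of kinks
  contribute steps over the same gap, one up and one down, so only \<open>p + q\<close> matters for the polynomial;
  but only the second kind has a warping crossing.
\<close>

fun kinks :: "bool \<Rightarrow> nat \<Rightarrow> bool list" where
  "kinks b 0 = []"
| "kinks b (Suc n) = (b # [\<not> b]) @ kinks b n"

fun nest :: "(nat \<times> nat) list \<Rightarrow> bool list" where
  "nest [] = []"
| "nest ((p, q) # ps) = kinks True p @ (True # (kinks False q @ nest ps) @ [\<not> True])"

lemma walk_end_kinks: "b \<or> d > 0 \<Longrightarrow> walk_end d (kinks b n) = d"
  by (induction n) (auto simp: walk_step_def)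

lemma walk_end_nest: "walk_end d (nest ps) = d"
  by (induction ps arbitrary: d rule: nest.induct) (auto simp: walk_end_append walk_end_kinks walk_step_def)

lemma walk_poly_kinks:
  "walk_poly d (kinks True n) = monom (int n) d + monom (int n) (d + 1)"
  "walk_poly (Suc d) (kinks False n) = monom (int n) d + monom (int n) (d + 1)"
  by (induction n) (auto simp: walk_step_def add_monom[symmetric] algebra_simps walk_poly_append)

lemma walk_poly_nest:
  "walk_poly d (nest ps) = (\<Sum>i<length ps. 
     monom (int (fst (ps ! i) + snd (ps ! i) + 1)) (d + i) + monom (int (fst (ps ! i) + snd (ps ! i) + 1)) (d + i + 1))"
proof (induction ps arbitrary: d rule: nest.induct)
  case (2 p q ps)
  show ?case
    by (simp add: walk_poly_append walk_end_append walk_end_kinks walk_end_nest walk_poly_kinks walk_step_def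
        2 sum.lessThan_Suc_shift add_monom[symmetric] algebra_simps del: sum.lessThan_Suc)
qed simp

text \<open>
  Gap \<open>i\<close> carries \<open>m i - 1\<close> kinks besides the large loop, and \<open>q i\<close> of them are to be passed first
  from below.  The hypothesis says exactly that \<open>k\<close> kinks can be chosen in this way.
\<close>

lemma bounded_split:
  fixes m :: "nat \<Rightarrow> int"
  assumes "\<forall>i<l. m i \<ge> 1" "(\<Sum>i<l. m i) \<ge> int k + int l"
  shows "\<exists>q. (\<forall>i<l. int (q i) + 1 \<le> m i) \<and> (\<Sum>i<l. q i) = k"
  using assms
proof (induction l arbitrary: k)
  case (Suc l)
  define x where "x = min k (nat (m l - 1))"
  have ml: "m l \<ge> 1" using Suc.prems by simp
  have "(\<Sum>i<l. m i) \<ge> (\<Sum>i<l. 1)" using Suc.prems(1) by (intro sum_mono) auto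
  then have sl: "(\<Sum>i<l. m i) \<ge> int l" by simp
  have "(\<Sum>i<l. m i) \<ge> int (k - x) + int l"
    using Suc.prems(2) sl ml unfolding x_def by (auto simp: min_def of_nat_diff)
  from Suc.IH[OF _ this] Suc.prems(1) obtain q where q: "\<forall>i<l. int (q i) + 1 \<le> m i" "(\<Sum>i<l. q i) = k - x" by auto
  have "x \<le> k" "int x + 1 \<le> m l" using ml by (auto simp: x_def)
  then show ?case using q
    by (intro exI[of _ "q(l := x)"]) (auto simp: less_Suc_eq)
qed simp

section \<open>Warping degrees along a diagram\<close>

lemma periodic_add_int:
  fixes f :: "real \<Rightarrow> 'a"
  assumes "\<And>t. f (t + 1) = f t"
  shows "f (t + of_int n) = f t"
proof -
  have nat: "f (t + real n) = f t" for t n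
  proof (induction n)
    case (Suc n)
    have "f (t + real (Suc n)) = f ((t + real n) + 1)" by (simp add: algebra_simps)
    then show ?case using assms Suc by metis
  qed simp
  show ?thesis
  proof (cases "n \<ge> 0")
    case True
    then show ?thesis using nat[of t "nat n"] by simp
  next
    case False
    then have "t + of_int n + real (nat (- n)) = t" by simp
    then show ?thesis using nat[of "t + of_int n" "nat (- n)"] by metis
  qed
qed

lemma Ints_diffE:
  fixes s t :: real
  assumes "s - t \<in> \<int>"
  obtains n where "s = t + of_int n"
proof -
  from assms obtain n where "s - t = of_int n" by (rule Ints_cases)
  then have "s = t + of_int n" by simp
  then show thesis by (rule that)
qed

lemma frac_eq_imp_diff_Ints:
  fixes s t :: real
  assumes "frac s = frac t"
  shows "s - t \<in> \<int>"
proof -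
  have "s - t = of_int (\<lfloor>s\<rfloor> - \<lfloor>t\<rfloor>)" using assms by (simp add: frac_def)
  then show ?thesis by (simp only: Ints_of_int)
qed

lemma Ints_diff_less_one:
  fixes s t :: real
  assumes "s - t \<in> \<int>" "s < t + 1" "t < s + 1"
  shows "s = t"
  using Ints_nonzero_abs_less1[OF assms(1)] assms by (auto simp: abs_less_iff)

text \<open>
  Times range over all reals, as this allows to start a turn around the diagram anywhere; two times are
  the same point of the circle if and only if they differ by an integer.
\<close>

locale knot =
  fixes D :: diagram
  assumes knot: "knot_diagram D"
begin

abbreviation "c \<equiv> curve D"

definition at_crossing :: "real \<Rightarrow> bool" where
  "at_crossing t \<longleftrightarrow> c t \<in> crossings D"

lemma c_add_int: "c (t + of_int n) = c t"
  using knot by (intro periodic_add_int) (auto simp: knot_diagram_def)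

lemma over_add_int: "over D (t + of_int n) = over D t"
  using knot by (intro periodic_add_int) (auto simp: knot_diagram_def)

lemma c_diff_Ints: "s - t \<in> \<int> \<Longrightarrow> c s = c t"
  by (erule Ints_diffE) (simp add: c_add_int)

lemma over_diff_Ints: "s - t \<in> \<int> \<Longrightarrow> over D s = over D t"
  by (erule Ints_diffE) (simp add: over_add_int)

lemma frac_diff_Ints: "frac t - t \<in> \<int>" for t :: real
  by (simp add: frac_def)

lemma frac_in: "frac t \<in> {0..<1}" for t :: real
  by (simp add: frac_lt_1)

lemma collide:
  assumes "c s = c t" "s - t \<notin> \<int>"
  shows "at_crossing s"
proof -
  have "frac s \<noteq> frac t" using assms(2) frac_eq_imp_diff_Ints by blast
  moreover have "c (frac s) = c s" "c (frac t) = c s"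
    using c_diff_Ints frac_diff_Ints assms(1) by metis+
  ultimately show ?thesis unfolding at_crossing_def crossings_def using frac_in by blast
qed

lemma no_triple_point:
  assumes "s \<in> {0..<1}" "t \<in> {0..<1}" "u \<in> {0..<1}" "c s = c t" "c t = c u"
  shows "s = t \<or> t = u \<or> s = u"
  using knot assms unfolding knot_diagram_def by blast

lemma over_opposite:
  assumes "s \<in> {0..<1}" "t \<in> {0..<1}" "s \<noteq> t" "c s = c t"
  shows "over D s \<noteq> over D t"
  using knot assms unfolding knot_diagram_def by blast

lemma finite_crossings: "finite (crossings D)"
  using knot by (simp add: knot_diagram_def)

lemma at_crossing_shift: "s - t \<in> \<int> \<Longrightarrow> at_crossing s = at_crossing t"
  using c_diff_Ints by (simp add: at_crossing_def)

lemma same_base_time: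
  assumes "c s = c r" "\<not> at_crossing r"
  shows "s - r \<in> \<int>"
  using assms collide[of s r] by (auto simp: at_crossing_def)

text \<open>
  In one turn from a base point, each crossing is met exactly twice, because there are no triple points.
  The two times in \<open>{0..<1}\<close> that the definition of a crossing provides are moved into the open
  interval from \<open>r\<close> to \<open>r + 1\<close>.
\<close>

lemma two_passes:
  assumes p: "p \<in> crossings D" and r: "\<not> at_crossing r"
  obtains s t where "r < s" "s < t" "t < r + 1" "c s = p" "c t = p" "over D s \<noteq> over D t"
    "\<forall>u. r < u \<and> u < r + 1 \<and> c u = p \<longrightarrow> u = s \<or> u = t"
proof -
  from p obtain a b where ab: "a \<in> {0..<1}" "b \<in> {0..<1}" "a \<noteq> b" "c a = p" "c b = p"
    unfolding crossings_def by blast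
  have third: "u = a \<or> u = b" if "u \<in> {0..<1}" "c u = p" for u
    using no_triple_point[of a b u] ab that by auto
  have ov: "over D a \<noteq> over D b" using over_opposite[of a b] ab by simp
  define sh where "sh u = r + frac (u - r)" for u
  have shI: "sh u - u \<in> \<int>" for u
    using frac_diff_Ints[of "u - r"] by (simp add: sh_def algebra_simps)
  have sh_id: "sh u = u" if "r < u" "u < r + 1" for u
    using that frac_eq[of "u - r"] by (simp add: sh_def)
  have sh_eq: "sh u = sh v" if uv: "u - v \<in> \<int>" for u v
  proof -
    obtain n where "u = v + of_int n" using uv by (rule Ints_diffE)
    then have "u - r = (v - r) + of_int n" by simp
    then have "frac (u - r) = frac (v - r)" by (simp only: frac_add_of_int_right)
    then show ?thesis by (simp add: sh_def)
  qed
  have sh_range: "r < sh u \<and> sh u < r + 1" if "c u = p" for u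
  proof -
    have "c (sh u) = p" using c_diff_Ints[OF shI] that by simp
    then have "sh u \<noteq> r" using p r by (auto simp: at_crossing_def)
    moreover have "r \<le> sh u" "sh u < r + 1" using frac_in[of "u - r"] by (auto simp: sh_def)
    ultimately show ?thesis by simp
  qed
  have ne: "sh a \<noteq> sh b"
  proof
    assume "sh a = sh b"
    then have "a - b = (sh b - b) - (sh a - a)" by simp
    then have "a - b \<in> \<int>" using Ints_diff[OF shI[of b] shI[of a]] by simp
    then show False using Ints_diff_less_one[of a b] ab by auto
  qed
  have pass: "u = sh a \<or> u = sh b" if "r < u" "u < r + 1" "c u = p" for u
  proof -
    have "c (frac u) = p" using c_diff_Ints[OF frac_diff_Ints] that by simp
    then have "frac u = a \<or> frac u = b" using third frac_in by blast
    then have "sh u = sh a \<or> sh u = sh b"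
      using sh_eq frac_diff_Ints by metis
    then show ?thesis using sh_id that by simp
  qed
  have vals: "c (sh a) = p" "c (sh b) = p" using c_diff_Ints[OF shI] ab by auto
  have ov': "over D (sh a) \<noteq> over D (sh b)" using over_diff_Ints[OF shI] ov by simp
  show thesis
  proof (cases "sh a < sh b")
    case True
    then show ?thesis using that[of "sh a" "sh b"] sh_range ab vals ov' pass by blast
  next
    case False
    then have "sh b < sh a" using ne by simp
    then show ?thesis using that[of "sh b" "sh a"] sh_range ab vals ov' pass by blast
  qed
qed

definition first_under :: "real \<Rightarrow> real ^ 3 \<Rightarrow> bool" where
  "first_under r p \<longleftrightarrow>
    (\<exists>s t. r < s \<and> s < t \<and> t < r + 1 \<and> c s = p \<and> c t = p \<and> \<not> over D s)"

lemma first_under_crossing: "first_under r p \<Longrightarrow> p \<in> crossings D"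
proof -
  assume "first_under r p"
  then obtain s t where st: "r < s" "s < t" "t < r + 1" "c s = p" "c t = p"
    unfolding first_under_def by blast
  then have "s - t \<notin> \<int>" using Ints_diff_less_one[of s t] by auto
  then show ?thesis using collide[of s t] st by (simp add: at_crossing_def)
qed

lemma first_under_iff:
  assumes "\<not> at_crossing r" "r < s" "s < t" "t < r + 1" "c s = p" "c t = p"
  shows "first_under r p \<longleftrightarrow> \<not> over D s"
proof
  assume "first_under r p"
  then obtain s' t' where st: "r < s'" "s' < t'" "t' < r + 1" "c s' = p" "c t' = p" "\<not> over D s'"
    unfolding first_under_def by blast
  obtain a b where ab: "r < a" "a < b" "b < r + 1" "c a = p" "c b = p" "over D a \<noteq> over D b"
    "\<forall>u. r < u \<and> u < r + 1 \<and> c u = p \<longrightarrow> u = a \<or> u = b"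
    by (rule two_passes[OF first_under_crossing[OF \<open>first_under r p\<close>] assms(1)])
  have "s = a" "s' = a" using ab(2) ab(7)[rule_format, of s] ab(7)[rule_format, of t] ab(7)[rule_format, of s'] ab(7)[rule_format, of t'] assms st by auto
  then show "\<not> over D s" using st by simp
next
  assume "\<not> over D s"
  then show "first_under r p" unfolding first_under_def using assms by blast
qed

lemma warping_iff_first_under:
  assumes r: "\<not> at_crossing r"
  shows "warping_crossing D (c r) p \<longleftrightarrow> first_under r p"
proof
  assume "warping_crossing D (c r) p"
  then obtain r' t where p: "p \<in> crossings D" and r': "c r' = c r" and t: "r' < t" "t < r' + 1" "c t = p"
    and first: "\<And>u. r' < u \<Longrightarrow> u < t \<Longrightarrow> c u \<noteq> p" and ov: "\<not> over D t"
    unfolding warping_crossing_def by blast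
  from same_base_time[OF r' r] obtain n where n: "r' = r + of_int n"
    by (rule Ints_diffE)
  obtain a b where ab: "r < a" "a < b" "b < r + 1" "c a = p" "c b = p" "over D a \<noteq> over D b"
    "\<forall>u. r < u \<and> u < r + 1 \<and> c u = p \<longrightarrow> u = a \<or> u = b"
    by (rule two_passes[OF p r])
  define v where "v = t - of_int n"
  have tv: "t = v + of_int n" by (simp add: v_def)
  have cv: "c v = p" using t(3) unfolding tv c_add_int .
  have vr: "r < v" "v < r + 1" using t n tv by auto
  have "\<not> a < v"
  proof
    assume "a < v"
    then have "c (a + of_int n) \<noteq> p" using first[of "a + of_int n"] ab(1) n tv by auto
    then show False unfolding c_add_int using ab(4) by simp
  qed
  then have "v = a" using ab(7)[rule_format, of v] vr cv ab(2) by auto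
  then have "\<not> over D a" using ov unfolding tv over_add_int by simp
  then show "first_under r p" unfolding first_under_def using ab by blast
next
  assume f: "first_under r p"
  then obtain s t where st: "r < s" "s < t" "t < r + 1" "c s = p" "c t = p" "\<not> over D s"
    unfolding first_under_def by blast
  obtain a b where ab: "r < a" "a < b" "b < r + 1" "c a = p" "c b = p" "over D a \<noteq> over D b"
    "\<forall>u. r < u \<and> u < r + 1 \<and> c u = p \<longrightarrow> u = a \<or> u = b"
    by (rule two_passes[OF first_under_crossing[OF f] r])
  have "s = a" using ab(2) ab(7)[rule_format, of s] ab(7)[rule_format, of t] st by auto
  then have "\<forall>u. r < u \<and> u < s \<longrightarrow> c u \<noteq> p" using ab(2,3) ab(7) by force
  then show "warping_crossing D (c r) p"
    unfolding warping_crossing_def using first_under_crossing[OF f] st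
    by (intro conjI exI[of _ r] exI[of _ s]) auto
qed

definition degree_at :: "real \<Rightarrow> nat" where
  "degree_at r = warping_degree D (c r)"

lemma degree_at_eq:
  assumes "\<not> at_crossing r"
  shows "degree_at r = card {p. first_under r p}"
  using warping_iff_first_under[OF assms] by (simp add: degree_at_def warping_degree_def)

lemma finite_first_under: "finite {p. first_under r p}"
  by (rule finite_subset[OF _ finite_crossings]) (auto intro: first_under_crossing)

lemma degree_at_le: "\<not> at_crossing r \<Longrightarrow> degree_at r \<le> card (crossings D)"
  unfolding degree_at_eq by (rule card_mono[OF finite_crossings]) (auto intro: first_under_crossing)

text \<open>
  Only a base point that moves over the crossing \<open>p\<close> itself can change the order of the two passages
  through \<open>p\<close>.
\<close>

lemma first_under_unpassed:
  assumes "r < r'" "r' < r + 1" "\<not> at_crossing r" "\<not> at_crossing r'"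
    and np: "\<And>u. r < u \<Longrightarrow> u < r' \<Longrightarrow> c u \<noteq> p"
  shows "first_under r p \<longleftrightarrow> first_under r' p"
proof
  assume f: "first_under r p"
  then obtain s t where st: "r < s" "s < t" "t < r + 1" "c s = p" "c t = p" "\<not> over D s"
    unfolding first_under_def by blast
  have "s \<noteq> r'" using first_under_crossing[OF f] assms(4) st by (auto simp: at_crossing_def)
  then have "r' < s" using np[of s] st by force
  then show "first_under r' p" unfolding first_under_def using st assms
    by (intro exI[of _ s] exI[of _ t]) auto
next
  assume f: "first_under r' p"
  then obtain s t where st: "r' < s" "s < t" "t < r' + 1" "c s = p" "c t = p" "\<not> over D s"
    unfolding first_under_def by blast
  have c1: "c (t - 1) = c t" by (rule c_diff_Ints) simp
  then have "t - 1 \<noteq> r" using first_under_crossing[OF f] assms(3) st by (auto simp: at_crossing_def)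
  moreover have "\<not> r < t - 1" using np[of "t - 1"] c1 st by auto
  ultimately show "first_under r p" unfolding first_under_def using st assms
    by (intro exI[of _ s] exI[of _ t]) auto
qed

lemma degree_at_const:
  assumes "r < r'" "r' < r + 1" "\<And>u. r \<le> u \<Longrightarrow> u \<le> r' \<Longrightarrow> \<not> at_crossing u"
  shows "degree_at r = degree_at r'"
proof -
  have "first_under r p \<longleftrightarrow> first_under r' p" for p
  proof (cases "p \<in> crossings D")
    case True
    with assms show ?thesis by (intro first_under_unpassed) (auto simp: at_crossing_def)
  next
    case False
    then show ?thesis using first_under_crossing by blast
  qed
  then show ?thesis using degree_at_eq[of r] degree_at_eq[of r'] assms by simp
qed

text \<open>
  When the base point moves over a passage \<open>\<tau>\<close>, this passage turns from the first into the second one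
  through its crossing.  If it is an over-passage, the crossing becomes a warping crossing, and if it is an
  under-passage, the crossing ceases to be one.
\<close>

lemma degree_at_step:
  assumes rr: "r < \<tau>" "\<tau> < r'" "r' < r + 1" "\<not> at_crossing r" "\<not> at_crossing r'"
    and \<tau>: "at_crossing \<tau>" and only: "\<And>u. r < u \<Longrightarrow> u < r' \<Longrightarrow> at_crossing u \<Longrightarrow> u = \<tau>"
  shows "degree_at r' = walk_step (over D \<tau>) (degree_at r)" "over D \<tau> \<or> degree_at r > 0"
proof -
  define p where "p = c \<tau>"
  have p: "p \<in> crossings D" using \<tau> by (simp add: p_def at_crossing_def)
  obtain s t where st: "r < s" "s < t" "t < r + 1" "c s = p" "c t = p" "over D s \<noteq> over D t"
    "\<forall>u. r < u \<and> u < r + 1 \<and> c u = p \<longrightarrow> u = s \<or> u = t"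
    by (rule two_passes[OF p rr(4)])
  have at: "at_crossing s" "at_crossing t" using st p by (auto simp: at_crossing_def)
  have "\<tau> = s \<or> \<tau> = t" using st(7)[rule_format, of \<tau>] rr by (simp add: p_def)
  then have s: "s = \<tau>" using only[of s] at st rr by auto
  \<comment> \<open>The other passage \<open>t\<close> comes first when seen from \<open>r'\<close>, and \<open>\<tau>\<close> comes back at \<open>\<tau> + 1\<close>.\<close>
  have "t \<noteq> r'" using at rr by auto
  then have t: "r' < t" using only[of t] at st s by force
  have before: "first_under r p \<longleftrightarrow> \<not> over D \<tau>"
    using first_under_iff[OF rr(4) st(1-5)] s by simp
  have "c (\<tau> + 1) = p" using c_diff_Ints[of "\<tau> + 1" \<tau>] by (simp add: p_def)
  then have after: "first_under r' p \<longleftrightarrow> over D \<tau>"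
    using first_under_iff[OF rr(5) t, of "\<tau> + 1" p] st s rr by auto
  have other: "first_under r q \<longleftrightarrow> first_under r' q" if "q \<noteq> p" for q
  proof (cases "q \<in> crossings D")
    case True
    have "c u \<noteq> q" if "r < u" "u < r'" for u
      using only[OF that] True \<open>q \<noteq> p\<close> by (auto simp: at_crossing_def p_def)
    with rr show ?thesis by (intro first_under_unpassed) auto
  next
    case False
    then show ?thesis using first_under_crossing by blast
  qed
  have "degree_at r' = walk_step (over D \<tau>) (degree_at r) \<and> (over D \<tau> \<or> degree_at r > 0)"
  proof (cases "over D \<tau>")
    case True
    have "first_under r' q \<longleftrightarrow> q = p \<or> first_under r q" for q
      using True before after other[of q] by (cases "q = p") auto
    then have "{q. first_under r' q} = insert p {q. first_under r q}" "p \<notin> {q. first_under r q}"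
      using True before by auto
    then show ?thesis using True degree_at_eq[OF rr(4)] degree_at_eq[OF rr(5)] finite_first_under[of r]
      by (simp add: walk_step_def)
  next
    case False
    have "first_under r q \<longleftrightarrow> q = p \<or> first_under r' q" for q
      using False before after other[of q] by (cases "q = p") auto
    then have "{q. first_under r q} = insert p {q. first_under r' q}" "p \<notin> {q. first_under r' q}"
      using False after by auto
    then show ?thesis using False degree_at_eq[OF rr(4)] degree_at_eq[OF rr(5)] finite_first_under[of r']
      by (simp add: walk_step_def)
  qed
  then show "degree_at r' = walk_step (over D \<tau>) (degree_at r)" "over D \<tau> \<or> degree_at r > 0" by auto
qed

lemma finite_crossing_times: "finite {t \<in> {a..b}. at_crossing t}"
proof -
  define F where "F = {t \<in> {0..<1}. at_crossing t}"
  have "F \<subseteq> (\<Union>p\<in>crossings D. {t \<in> {0..<1}. c t = p})"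
    unfolding F_def by (auto simp: at_crossing_def)
  moreover have "finite {t \<in> {0..<1}. c t = p}" if p: "p \<in> crossings D" for p
  proof -
    from p obtain a b where ab: "a \<in> {0..<1}" "b \<in> {0..<1}" "a \<noteq> b" "c a = p" "c b = p"
      unfolding crossings_def by blast
    have "u = a \<or> u = b" if "u \<in> {0..<1}" "c u = p" for u
      using no_triple_point[of a b u] ab that by auto
    then have "{t \<in> {0..<1}. c t = p} \<subseteq> {a, b}" by blast
    then show ?thesis by (rule finite_subset) simp
  qed
  ultimately have "finite F" by (rule finite_subset[OF _ finite_UN_I[OF finite_crossings]])
  then have "finite ((\<lambda>(v, n). v + of_int n) ` (F \<times> {\<lfloor>a\<rfloor>..\<lfloor>b\<rfloor>}))" by simp
  moreover have "{t \<in> {a..b}. at_crossing t} \<subseteq> (\<lambda>(v, n). v + of_int n) ` (F \<times> {\<lfloor>a\<rfloor>..\<lfloor>b\<rfloor>})"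
  proof
    fix t assume t: "t \<in> {t \<in> {a..b}. at_crossing t}"
    have "frac t \<in> F" using t at_crossing_shift[OF frac_diff_Ints] frac_in by (simp add: F_def frac_lt_1)
    moreover have "\<lfloor>t\<rfloor> \<in> {\<lfloor>a\<rfloor>..\<lfloor>b\<rfloor>}" using t by (auto intro: floor_mono)
    moreover have "t = frac t + of_int \<lfloor>t\<rfloor>" by (simp add: frac_def)
    ultimately show "t \<in> (\<lambda>(v, n). v + of_int n) ` (F \<times> {\<lfloor>a\<rfloor>..\<lfloor>b\<rfloor>})" by force
  qed
  ultimately show ?thesis by (rule finite_subset[rotated])
qed

lemma base_time_between:
  assumes "a < b"
  obtains r where "a < r" "r < b" "\<not> at_crossing r"
proof -
  have "infinite ({a<..<b} - {t \<in> {a..b}. at_crossing t})"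
    using finite_crossing_times assms by (simp add: Diff_infinite_finite)
  then obtain r where "r \<in> {a<..<b} - {t \<in> {a..b}. at_crossing t}"
    by (metis finite.emptyI ex_in_conv)
  then show ?thesis using that by auto
qed

definition next_crossing :: "real \<Rightarrow> real" where
  "next_crossing t = Min {u \<in> {t<..t + 1}. at_crossing u}"

lemma next_crossing:
  assumes "at_crossing t"
  shows "at_crossing (next_crossing t)" "t < next_crossing t" "next_crossing t \<le> t + 1"
    "t < u \<Longrightarrow> u < next_crossing t \<Longrightarrow> \<not> at_crossing u"
proof -
  let ?S = "{u \<in> {t<..t + 1}. at_crossing u}"
  have fin: "finite ?S"
    by (rule finite_subset[OF _ finite_crossing_times[of t "t + 1"]]) auto
  have "t + 1 \<in> ?S" using assms at_crossing_shift[of "t + 1" t] by simp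
  then have "next_crossing t \<in> ?S" unfolding next_crossing_def using fin by (intro Min_in) auto
  then show *: "at_crossing (next_crossing t)" "t < next_crossing t" "next_crossing t \<le> t + 1" by auto
  show "\<not> at_crossing u" if "t < u" "u < next_crossing t"
  proof
    assume "at_crossing u"
    then have "u \<in> ?S" using that * by simp
    then have "next_crossing t \<le> u" unfolding next_crossing_def using fin by simp
    with that show False by simp
  qed
qed

lemma next_crossing_unique:
  assumes "a < b" "at_crossing a" "at_crossing b" "\<And>u. a < u \<Longrightarrow> u < b \<Longrightarrow> \<not> at_crossing u"
  shows "b = next_crossing a"
  using next_crossing(1,2,4)[OF assms(2)] assms(1,3,4)
  by (cases b "next_crossing a" rule: linorder_cases) auto

definition edge_from :: "real \<Rightarrow> (real ^ 3) set" where
  "edge_from t = c ` {t..next_crossing t}"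

definition times_after :: "real \<Rightarrow> real set" where
  "times_after r = {t. r < t \<and> t < r + 1 \<and> at_crossing t}"

lemma edge_from_degree:
  assumes t: "at_crossing t" and r: "t < r" "r < next_crossing t"
  shows "edge_warping_degree D (edge_from t) = degree_at r"
proof -
  note nx = next_crossing[OF t]
  have eq: "warping_degree D b = degree_at r" if b: "b \<in> edge_from t" "base_point D b" for b
  proof -
    from b obtain u where u: "u \<in> {t..next_crossing t}" "b = c u" by (auto simp: edge_from_def)
    have "\<not> at_crossing u" using b u by (auto simp: base_point_def at_crossing_def)
    then have "t < u" "u < next_crossing t" using u nx t by (auto simp: less_le)
    consider "u = r" | "u < r" | "r < u" by linarith
    then have "degree_at u = degree_at r"
    proof cases
      case 2
      then show ?thesis using nx r \<open>t < u\<close> by (intro degree_at_const) auto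
    next
      case 3
      then show ?thesis using nx r \<open>u < next_crossing t\<close> by (intro degree_at_const[symmetric]) auto
    qed simp
    then show ?thesis using u by (simp add: degree_at_def)
  qed
  have cr: "c r \<in> edge_from t" "base_point D (c r)"
    using r nx(4)[OF r] by (auto simp: edge_from_def base_point_def at_crossing_def)
  show ?thesis unfolding edge_warping_degree_def
  proof (rule the_equality)
    show "\<forall>b\<in>edge_from t. base_point D b \<longrightarrow> warping_degree D b = degree_at r"
      using eq by blast
  next
    fix i assume "\<forall>b\<in>edge_from t. base_point D b \<longrightarrow> warping_degree D b = i"
    then have "warping_degree D (c r) = i" using cr by blast
    then show "i = degree_at r" by (simp add: degree_at_def)
  qed
qed

lemma next_crossing_add_int:
  assumes "at_crossing t"
  shows "next_crossing (t + of_int n) = next_crossing t + of_int n"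
proof (rule next_crossing_unique[symmetric])
  show "at_crossing (t + of_int n)" using assms at_crossing_shift[of "t + of_int n" t] by simp
  show "at_crossing (next_crossing t + of_int n)"
    using next_crossing[OF assms] at_crossing_shift[of "next_crossing t + of_int n" "next_crossing t"] by simp
  show "\<not> at_crossing u" if "t + of_int n < u" "u < next_crossing t + of_int n" for u
    using next_crossing(4)[OF assms, of "u - of_int n"] that at_crossing_shift[of u "u - of_int n"] by simp
qed (use next_crossing[OF assms] in simp)

lemma edge_from_diff_Ints:
  assumes "at_crossing t" "s - t \<in> \<int>"
  shows "edge_from s = edge_from t"
proof -
  from assms(2) obtain n where s: "s = t + of_int n" by (rule Ints_diffE)
  have "{s..next_crossing s} = (\<lambda>u. u + of_int n) ` {t..next_crossing t}"
    unfolding s next_crossing_add_int[OF assms(1)] by (simp add: image_add_atLeastAtMost')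
  then show ?thesis unfolding edge_from_def by (simp only: image_image c_add_int)
qed

text \<open>
  Each edge is named by the time of the turn from \<open>r\<close> at which it begins; by \<open>inj_on_edge_from\<close> this
  naming is unique, so that a sum over edges becomes a sum over crossing times.
\<close>

lemma edges_eq:
  assumes r: "\<not> at_crossing r" and ne: "crossings D \<noteq> {}"
  shows "edges D = edge_from ` times_after r"
proof -
  have "edges D = {edge_from t | t. at_crossing t}"
  proof -
    have "(\<exists>a b. e = c ` {a..b} \<and> a < b \<and> c a \<in> crossings D \<and> c b \<in> crossings D \<and>
              (\<forall>t. a < t \<and> t < b \<longrightarrow> c t \<notin> crossings D)) \<longleftrightarrow> (\<exists>t. e = edge_from t \<and> at_crossing t)" for e
    proof
      assume "\<exists>a b. e = c ` {a..b} \<and> a < b \<and> c a \<in> crossings D \<and> c b \<in> crossings D \<and>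
              (\<forall>t. a < t \<and> t < b \<longrightarrow> c t \<notin> crossings D)"
      then obtain a b where ab: "e = c ` {a..b}" "a < b" "at_crossing a" "at_crossing b"
        "\<And>t. a < t \<Longrightarrow> t < b \<Longrightarrow> \<not> at_crossing t" unfolding at_crossing_def by blast
      then show "\<exists>t. e = edge_from t \<and> at_crossing t"
        using next_crossing_unique[OF ab(2-5)] unfolding edge_from_def by blast
    next
      assume "\<exists>t. e = edge_from t \<and> at_crossing t"
      then obtain t where t: "e = edge_from t" "at_crossing t" by blast
      then show "\<exists>a b. e = c ` {a..b} \<and> a < b \<and> c a \<in> crossings D \<and> c b \<in> crossings D \<and>
              (\<forall>t. a < t \<and> t < b \<longrightarrow> c t \<notin> crossings D)"
        using next_crossing[OF t(2)] unfolding edge_from_def at_crossing_def by blast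
    qed
    then show ?thesis unfolding edges_def using ne by auto
  qed
  also have "\<dots> = edge_from ` times_after r"
  proof -
    have shift: "\<exists>s. s - t \<in> \<int> \<and> s \<in> times_after r" if t: "at_crossing t" for t
    proof -
      define s where "s = r + frac (t - r)"
      have sI: "s - t \<in> \<int>" using frac_diff_Ints[of "t - r"] by (simp add: s_def algebra_simps)
      then have "at_crossing s" using t at_crossing_shift by simp
      moreover have "r \<le> s" "s < r + 1" using frac_in[of "t - r"] by (auto simp: s_def)
      ultimately show ?thesis using r sI unfolding times_after_def
        by (intro exI[of _ s]) (auto simp: less_le)
    qed
    show ?thesis
    proof (intro equalityI subsetI)
      fix e assume "e \<in> {edge_from t | t. at_crossing t}"
      then obtain t where t: "e = edge_from t" "at_crossing t" by blast
      from shift[OF t(2)] obtain s where "s - t \<in> \<int>" "s \<in> times_after r" by blast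
      then show "e \<in> edge_from ` times_after r" using edge_from_diff_Ints[OF t(2)] t(1) by blast
    qed (auto simp: times_after_def)
  qed
  finally show ?thesis .
qed

text \<open>
  Distinct edges could share their end points, so they are told apart by an interior point: it is no
  crossing, so the curve passes it only once per turn.
\<close>

lemma inj_on_edge_from: "inj_on edge_from (times_after r)"
proof (rule inj_onI)
  fix t t' assume t: "t \<in> times_after r" "t' \<in> times_after r" and e: "edge_from t = edge_from t'"
  then have X: "at_crossing t" "at_crossing t'" by (auto simp: times_after_def)
  note nx = next_crossing[OF X(1)] and nx' = next_crossing[OF X(2)]
  define u where "u = (t + next_crossing t) / 2"
  have u: "t < u" "u < next_crossing t" using nx by (auto simp: u_def)
  then have "c u \<in> edge_from t'" using e unfolding edge_from_def by (metis atLeastAtMost_iff image_eqI less_imp_le)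
  then obtain v where v: "t' \<le> v" "v \<le> next_crossing t'" "c v = c u" by (auto simp: edge_from_def)
  have uX: "\<not> at_crossing u" using nx(4)[OF u] .
  then have "\<not> at_crossing v" using v by (simp add: at_crossing_def)
  then have v': "t' < v" "v < next_crossing t'" using v nx' X by (auto simp: less_le)
  from same_base_time[OF v(3) uX] obtain n where n: "v = u + of_int n"
    by (rule Ints_diffE)
  have X': "at_crossing (t + of_int n)" using X at_crossing_shift[of "t + of_int n" t] by simp
  have "t' = t + of_int n"
  proof (rule ccontr)
    assume "t' \<noteq> t + of_int n"
    then consider "t' < t + of_int n" | "t < t' - of_int n" by linarith
    then show False
    proof cases
      case 1
      then show False using nx'(4)[of "t + of_int n"] X' u v' n by auto
    next
      case 2
      have "at_crossing (t' - of_int n)" using X at_crossing_shift[of "t' - of_int n" t'] by simp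
      then show False using nx(4)[of "t' - of_int n"] 2 u v' n by auto
    qed
  qed
  then show "t = t'" using Ints_diff_less_one[of t' t] t by (auto simp: times_after_def)
qed

text \<open>
  Induction on the crossing times still ahead: move the base point from \<open>r\<close> over the next crossing time,
  onto the edge that begins there.
\<close>

lemma walk_along:
  assumes "\<not> at_crossing r" "\<not> at_crossing R" "r < R" "R \<le> r + 1"
    and "sorted_wrt (<) ts" "set ts = {t. r < t \<and> t < R \<and> at_crossing t}"
  shows "walk_in (card (crossings D)) (degree_at r) (map (over D) ts) \<and>
    walk_end (degree_at r) (map (over D) ts) = degree_at R \<and>
    (\<Sum>t\<leftarrow>ts. monom 1 (edge_warping_degree D (edge_from t))) = walk_poly (degree_at r) (map (over D) ts)"
  using assms
proof (induction ts arbitrary: r)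
  case Nil
  have "degree_at r = degree_at R"
  proof (cases "R = r + 1")
    case True
    then show ?thesis using c_diff_Ints[of R r] by (simp add: degree_at_def)
  next
    case False
    then show ?thesis using Nil by (intro degree_at_const) (auto simp: le_less)
  qed
  then show ?case using degree_at_le Nil by simp
next
  case (Cons t ts)
  have t: "r < t" "t < R" "at_crossing t" using Cons.prems(6) by auto
  note nx = next_crossing[OF t(3)]
  define r' where "r' = (t + min (next_crossing t) R) / 2"
  have r': "t < r'" "r' < next_crossing t" "r' < R" using nx t by (auto simp: r'_def)
  have nr': "\<not> at_crossing r'" using nx r' by blast
  have later: "u \<in> set ts \<longleftrightarrow> t < u \<and> u < R \<and> at_crossing u" for u
    using Cons.prems(5,6) t by (auto simp: set_eq_iff)
  have only: "u = t" if "r < u" "u < r'" "at_crossing u" for u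
  proof -
    have "u \<in> set (t # ts)" using that r' Cons.prems(6) by auto
    then show ?thesis using later nx(4)[of u] that r' by auto
  qed
  have st: "degree_at r' = walk_step (over D t) (degree_at r)" "over D t \<or> degree_at r > 0"
    using degree_at_step[OF t(1) r'(1) _ Cons.prems(1) nr' t(3) only] r'(3) Cons.prems(4) by auto
  have "u \<in> set ts \<longleftrightarrow> r' < u \<and> u < R \<and> at_crossing u" for u
    using later[of u] nx(4)[of u] nr' r' by (cases u r' rule: linorder_cases) auto
  then have "set ts = {t. r' < t \<and> t < R \<and> at_crossing t}" by blast
  moreover have "sorted_wrt (<) ts" "R \<le> r' + 1" using Cons.prems(4,5) r' t by auto
  ultimately
  have "walk_in (card (crossings D)) (degree_at r') (map (over D) ts) \<and>
    walk_end (degree_at r') (map (over D) ts) = degree_at R \<and>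
    (\<Sum>t\<leftarrow>ts. monom 1 (edge_warping_degree D (edge_from t))) = walk_poly (degree_at r') (map (over D) ts)"
    using Cons.IH[OF nr' Cons.prems(2) r'(3)] by blast
  then show ?case using st edge_from_degree[OF t(3) r'(1,2)] degree_at_le[OF Cons.prems(1)]
    by simp
qed

text \<open>
  After a full turn the base point is back on its edge, so the walk is closed.
\<close>

lemma warping_polynomial_walk:
  assumes r: "\<not> at_crossing r" and ne: "crossings D \<noteq> {}"
    and ts: "sorted_wrt (<) ts" "set ts = times_after r"
  shows "walk_in (card (crossings D)) (degree_at r) (map (over D) ts)"
    "walk_end (degree_at r) (map (over D) ts) = degree_at r"
    "warping_polynomial D = walk_poly (degree_at r) (map (over D) ts)"
proof -
  have r1: "\<not> at_crossing (r + 1)" "degree_at (r + 1) = degree_at r"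
    using r at_crossing_shift[of "r + 1" r] c_diff_Ints[of "r + 1" r] by (auto simp: degree_at_def)
  note walk = walk_along[OF r r1(1) _ _ ts(1) ts(2)[unfolded times_after_def], simplified]
  show "walk_in (card (crossings D)) (degree_at r) (map (over D) ts)"
    "walk_end (degree_at r) (map (over D) ts) = degree_at r"
    using walk r1 by auto
  have "distinct ts" using ts(1) by (simp add: strict_sorted_iff)
  have "warping_polynomial D = (\<Sum>t\<in>times_after r. monom 1 (edge_warping_degree D (edge_from t)))"
    unfolding warping_polynomial_def edges_eq[OF r ne] by (simp add: sum.reindex[OF inj_on_edge_from])
  also have "\<dots> = (\<Sum>t\<leftarrow>ts. monom 1 (edge_warping_degree D (edge_from t)))"
    using \<open>distinct ts\<close> ts(2) by (metis sum_list_distinct_conv_sum_set)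
  finally show "warping_polynomial D = walk_poly (degree_at r) (map (over D) ts)" using walk by simp
qed

lemma card_times_after:
  assumes r: "\<not> at_crossing r"
  shows "card (times_after r) = 2 * card (crossings D)"
proof -
  have two: "card {t. r < t \<and> t < r + 1 \<and> c t = p} = 2 \<and> finite {t. r < t \<and> t < r + 1 \<and> c t = p}"
    if p: "p \<in> crossings D" for p
  proof -
    obtain s t where "r < s" "s < t" "t < r + 1" "c s = p" "c t = p" "over D s \<noteq> over D t"
      "\<forall>u. r < u \<and> u < r + 1 \<and> c u = p \<longrightarrow> u = s \<or> u = t"
      by (rule two_passes[OF p r])
    then have "{t. r < t \<and> t < r + 1 \<and> c t = p} = {s, t}" "s \<noteq> t" by auto
    then show ?thesis by simp
  qed
  have "times_after r = (\<Union>p\<in>crossings D. {t. r < t \<and> t < r + 1 \<and> c t = p})"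
    by (auto simp: times_after_def at_crossing_def)
  also have "card \<dots> = (\<Sum>p\<in>crossings D. card {t. r < t \<and> t < r + 1 \<and> c t = p})"
    using two finite_crossings by (intro card_UN_disjoint) auto
  finally show ?thesis using two by simp
qed

lemma warping_polynomial_no_crossings:
  assumes "crossings D = {}"
  shows "warping_polynomial D = 1"
proof -
  have "edge_warping_degree D (range c) = 0"
    unfolding edge_warping_degree_def
    using assms by (intro the_equality) (auto simp: base_point_def warping_degree_def warping_crossing_def)
  then show ?thesis using assms by (simp add: warping_polynomial_def edges_def monom_0 one_pCons)
qed

lemma warping_polynomial_shape:
  "warping_polynomial D = 1 \<or> (\<exists>k l (m :: nat \<Rightarrow> int). l \<ge> 1 \<and> (\<forall>i<l. m i \<ge> 1) \<and>
    (\<Sum>i<l. m i) \<ge> int k + int l \<and>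
    warping_polynomial D = (\<Sum>i<l. monom (m i) (k + i) + monom (m i) (k + i + 1)))"
proof (cases "crossings D = {}")
  case False
  obtain r where r: "\<not> at_crossing r" using base_time_between[of 0 1] by auto
  define ts where "ts = sorted_list_of_set (times_after r)"
  have fin: "finite (times_after r)"
    by (rule finite_subset[OF _ finite_crossing_times[of r "r + 1"]]) (auto simp: times_after_def)
  have ts: "sorted_wrt (<) ts" "set ts = times_after r" "length ts = 2 * card (crossings D)"
    using fin card_times_after[OF r] by (auto simp: ts_def)
  have "ts \<noteq> []" using ts(3) False finite_crossings by auto
  note walk = warping_polynomial_walk[OF r False ts(1,2)]
  have "map (over D) ts \<noteq> []" "length (map (over D) ts) = 2 * card (crossings D)"
    using \<open>ts \<noteq> []\<close> ts(3) by auto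
  from closed_walk_poly[OF walk(1,2) this] show ?thesis unfolding walk(3) by blast
qed (use warping_polynomial_no_crossings in simp)

end

section \<open>Long arcs in the plane\<close>

text \<open>
  The derivative is one-sided at the end points of an interval.  This is what makes \<open>C\<^sup>1\<close> pieces with
  equal values and derivatives at a joint fit together.
\<close>

definition c1_on :: "(real \<Rightarrow> 'a::real_normed_vector) \<Rightarrow> (real \<Rightarrow> 'a) \<Rightarrow> real set \<Rightarrow> bool" where
  "c1_on f f' S \<longleftrightarrow> (\<forall>t\<in>S. (f has_vector_derivative f' t) (at t within S)) \<and> continuous_on S f'"

lemma has_vector_derivative_Un:
  assumes "(f has_vector_derivative v) (at t within S)" "(f has_vector_derivative v) (at t within T)"
  shows "(f has_vector_derivative v) (at t within (S \<union> T))"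
  using assms unfolding has_vector_derivative_def has_derivative_within
  by (auto simp: at_within_union intro: filterlim_sup)

text \<open>
  Away from a closed set the filter is trivial.  Thus \<open>c1_on_Un\<close> need not treat joints separately.
\<close>

lemma has_vector_derivative_off_closed:
  assumes "closed S" "t \<notin> S"
  shows "(f has_vector_derivative v) (at t within S)"
proof -
  have "at t within S = bot" using assms by (simp add: at_within_eq_bot_iff)
  then show ?thesis
    unfolding has_vector_derivative_def has_derivative_within
    by (simp add: bounded_linear_scaleR_left)
qed

lemma c1_on_Un:
  assumes "closed S" "closed T" "c1_on f f' S" "c1_on f f' T"
  shows "c1_on f f' (S \<union> T)"
proof -
  have "(f has_vector_derivative f' t) (at t within (S \<union> T))" if "t \<in> S \<union> T" for t
    using assms that
    by (cases "t \<in> S"; cases "t \<in> T")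
      (auto simp: c1_on_def intro: has_vector_derivative_Un has_vector_derivative_off_closed)
  then show ?thesis using assms continuous_on_closed_Un[of S T f'] by (auto simp: c1_on_def)
qed

lemma c1_on_cong:
  assumes "c1_on f f' S" "\<And>t. t \<in> S \<Longrightarrow> g t = f t" "\<And>t. t \<in> S \<Longrightarrow> g' t = f' t"
  shows "c1_on g g' S"
proof -
  have "(g has_vector_derivative f' t) (at t within S)" if t: "t \<in> S" for t
  proof -
    have "(f has_vector_derivative f' t) (at t within S)" using assms(1) t by (simp add: c1_on_def)
    from has_vector_derivative_transform[OF t assms(2) this] show ?thesis by simp
  qed
  then show ?thesis using assms continuous_on_cong[of S S g' f'] by (auto simp: c1_on_def)
qed

lemma c1_on_affine:
  fixes f :: "real \<Rightarrow> complex"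
  assumes "c1_on f f' S" "\<And>t. t \<in> T \<Longrightarrow> a * t + b \<in> S"
  shows "c1_on (\<lambda>t. z + w * f (a * t + b)) (\<lambda>t. w * (a * f' (a * t + b))) T"
  unfolding c1_on_def
proof (intro conjI ballI)
  fix t assume t: "t \<in> T"
  let ?h = "\<lambda>t. a * t + b"
  have "(?h has_vector_derivative a) (at t within T)"
    by (auto intro!: derivative_eq_intros simp: has_real_derivative_iff_has_vector_derivative[symmetric])
  moreover have "(f has_vector_derivative f' (?h t)) (at (?h t) within ?h ` T)"
  proof (rule has_vector_derivative_within_subset)
    show "(f has_vector_derivative f' (?h t)) (at (?h t) within S)"
      using assms t by (simp add: c1_on_def)
    show "?h ` T \<subseteq> S" using assms(2) by blast
  qed
  ultimately have "(f \<circ> ?h has_vector_derivative a *\<^sub>R f' (?h t)) (at t within T)"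
    by (rule vector_diff_chain_within)
  then have "((\<lambda>t. f (a * t + b)) has_vector_derivative a *\<^sub>R f' (?h t)) (at t within T)" 
    by (simp add: o_def)
  then show "((\<lambda>t. z + w * f (a * t + b)) has_vector_derivative w * (a * f' (a * t + b))) (at t within T)"
    by (auto intro!: derivative_eq_intros simp: scaleR_conv_of_real)
next
  have "continuous_on T (\<lambda>t. f' (a * t + b))"
    by (rule continuous_on_compose2[of S f']) (use assms in \<open>auto simp: c1_on_def intro!: continuous_intros\<close>)
  then show "continuous_on T (\<lambda>t. w * (a * f' (a * t + b)))" by (intro continuous_intros)
qed

text \<open>
  The end points of an arc are left out; they lie on the boundary of the box to which the arc is confined.
\<close>

definition double_times :: "(real \<Rightarrow> complex) \<Rightarrow> real \<Rightarrow> real \<Rightarrow> bool" where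
  "double_times g s t \<longleftrightarrow> s \<in> {0<..<1} \<and> t \<in> {0<..<1} \<and> s \<noteq> t \<and> g s = g t"

text \<open>
  A long arc runs from \<open>0\<close> to \<open>1\<close> and can be inserted, after a similarity, in place of a straight
  segment of another curve.  The common end velocity must be fixed in advance for the joints to be
  \<open>C\<^sup>1\<close> without reparametrisation.  The value \<open>5/2\<close> lies between two bounds: the quadratic \<open>5/2 - 9 t + 9 t\<^sup>2\<close>, the
  speed of the plain segment below, has integral \<open>1\<close> and is positive, for which an end velocity below
  \<open>3\<close> is necessary; and a quadratic motion that has to get past the middle of the box and turn around
  in less than half of the time needs an initial velocity above \<open>2\<close>.
\<close>

definition long_arc :: "(real \<Rightarrow> complex) \<Rightarrow> (real \<Rightarrow> complex) \<Rightarrow> bool" where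
  "long_arc g g' \<longleftrightarrow> c1_on g g' {0..1} \<and> g 0 = 0 \<and> g 1 = 1 \<and> g' 0 = 5/2 \<and> g' 1 = 5/2 \<and>
     (\<forall>t\<in>{0..1}. g' t \<noteq> 0) \<and>
     (\<forall>t\<in>{0<..<1}. 0 < Re (g t) \<and> Re (g t) < 1 \<and> \<bar>Im (g t)\<bar> < 1)"

text \<open>
  Transversality of \<open>g' s\<close> and \<open>g' t\<close> is the non-vanishing of their determinant, which is
  \<open>Im (cnj (g' s) * g' t)\<close>.  The list \<open>ts\<close> holds the crossing times in the order of the arc.
\<close>

definition generic_arc ::
  "(real \<Rightarrow> complex) \<Rightarrow> (real \<Rightarrow> complex) \<Rightarrow> (real \<Rightarrow> bool) \<Rightarrow> real list \<Rightarrow> bool" where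
  "generic_arc g g' ov ts \<longleftrightarrow> sorted_wrt (<) ts \<and> set ts = {t. \<exists>s. double_times g t s} \<and>
     (\<forall>s t u. double_times g s t \<and> double_times g s u \<longrightarrow> t = u) \<and>
     (\<forall>s t. double_times g s t \<longrightarrow> Im (cnj (g' s) * g' t) \<noteq> 0 \<and> ov s \<noteq> ov t)"

text \<open>
  There are no triple points, so a later partner of \<open>t\<close> shows that \<open>t\<close> is the first passage through its
  crossing.
\<close>

definition under_first :: "(real \<Rightarrow> complex) \<Rightarrow> (real \<Rightarrow> bool) \<Rightarrow> real set" where
  "under_first g ov = {t. \<not> ov t \<and> (\<exists>s>t. double_times g t s)}"

text \<open>
  The word of passages determines a warping polynomial only up to a shift of the exponents; the number
  \<open>k\<close> of crossings that are first met from below is the missing start level of the walk.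
\<close>

definition realizable :: "bool list \<Rightarrow> nat \<Rightarrow> bool" where
  "realizable w k \<longleftrightarrow> (\<exists>g g' ov ts. long_arc g g' \<and> generic_arc g g' ov ts \<and>
     map ov ts = w \<and> card (under_first g ov) = k)"

lemma double_times_sym: "double_times g s t \<longleftrightarrow> double_times g t s"
  by (auto simp: double_times_def)

lemma finite_under_first:
  assumes "generic_arc g g' ov ts"
  shows "finite (under_first g ov)"
proof -
  have "set ts = {t. \<exists>s. double_times g t s}" using assms by (simp add: generic_arc_def)
  then have "under_first g ov \<subseteq> set ts" by (auto simp: under_first_def)
  then show ?thesis by (rule finite_subset) simp
qed

lemma realizable_Nil: "realizable [] 0"
proof -
  define x :: "real \<Rightarrow> real" where "x t = 5/2 * t - 9/2 * t^2 + 3 * t^3" for t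
  define g g' where "g t = complex_of_real (x t)" and "g' t = complex_of_real (5/2 - 9 * t + 9 * t^2)" for t
  have mono: "x s < x t" if "s < t" for s t
  proof -
    have "x t - x s = (t - s) * (9/4 * (s + t - 1)^2 + 1/4 + 3/4 * (s - t)^2)"
      by (simp add: x_def power2_eq_square power3_eq_cube field_simps)
    moreover have "9/4 * (s + t - 1)^2 + 1/4 + 3/4 * (s - t)^2 > 0"
      by (intro add_nonneg_pos add_pos_nonneg) auto
    ultimately show ?thesis using that by (metis diff_gt_0_iff_gt mult_pos_pos)
  qed
  have nd: "\<not> double_times g s t" for s t
    using mono[of s t] mono[of t s] by (auto simp: double_times_def g_def) linarith
  have "c1_on g g' {0..1}"
    unfolding c1_on_def g_def g'_def x_def
    by (auto intro!: derivative_eq_intros continuous_intros simp: has_vector_derivative_complex_iff)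
  moreover have "5/2 - 9 * t + 9 * t^2 > 0" for t :: real
  proof -
    have "5/2 - 9 * t + 9 * t^2 = 9 * (t - 1/2)^2 + 1/4" by (simp add: power2_eq_square field_simps)
    moreover have "0 \<le> 9 * (t - 1/2)^2" by simp
    ultimately show ?thesis by linarith
  qed
  then have "g' t \<noteq> 0" for t unfolding g'_def by (metis less_irrefl of_real_eq_0_iff)
  moreover have "x 0 = 0" "x 1 = 1" by (auto simp: x_def)
  ultimately have "long_arc g g'"
    unfolding long_arc_def using mono[of 0] mono[of _ 1]
    by (auto simp: g_def g'_def)
  moreover have "generic_arc g g' (\<lambda>_. True) []" "under_first g (\<lambda>_. True) = {}"
    using nd by (auto simp: generic_arc_def under_first_def)
  ultimately show ?thesis unfolding realizable_def by (metis card.empty list.map(1))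
qed

text \<open>
  Two arcs scaled by \<open>1/2\<close> are put one after the other.  They run on the two sides of the line
  \<open>Re z = 1/2\<close>, so no new double points arise.
\<close>

lemma realizable_append:
  assumes "realizable w1 k1" "realizable w2 k2"
  shows "realizable (w1 @ w2) (k1 + k2)"
proof -
  from assms obtain g1 g1' ov1 ts1 g2 g2' ov2 ts2 where
    A1: "long_arc g1 g1'" and G1: "generic_arc g1 g1' ov1 ts1" and w1: "map ov1 ts1 = w1"
    and k1: "card (under_first g1 ov1) = k1" and
    A2: "long_arc g2 g2'" and G2: "generic_arc g2 g2' ov2 ts2" and w2: "map ov2 ts2 = w2"
    and k2: "card (under_first g2 ov2) = k2"
    unfolding realizable_def by blast
  define g where "g t = (if t \<le> 1/2 then g1 (2 * t) / 2 else 1/2 + g2 (2 * t - 1) / 2)" for t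
  define g' where "g' t = (if t \<le> 1/2 then g1' (2 * t) else g2' (2 * t - 1))" for t
  define ov where "ov t = (if t \<le> 1/2 then ov1 (2 * t) else ov2 (2 * t - 1))" for t
  define ts where "ts = map (\<lambda>t. t / 2) ts1 @ map (\<lambda>t. (1 + t) / 2) ts2"
  have e1: "g1 0 = 0" "g1 1 = 1" "g1' 0 = 5/2" "g1' 1 = 5/2" and b1: "0 < t \<Longrightarrow> t < 1 \<Longrightarrow> 0 < Re (g1 t) \<and> Re (g1 t) < 1 \<and> \<bar>Im (g1 t)\<bar> < 1"
    and n1: "0 \<le> t \<Longrightarrow> t \<le> 1 \<Longrightarrow> g1' t \<noteq> 0" and c1: "c1_on g1 g1' {0..1}" for t
    using A1 by (auto simp: long_arc_def)
  have e2: "g2 0 = 0" "g2 1 = 1" "g2' 0 = 5/2" "g2' 1 = 5/2" and b2: "0 < t \<Longrightarrow> t < 1 \<Longrightarrow> 0 < Re (g2 t) \<and> Re (g2 t) < 1 \<and> \<bar>Im (g2 t)\<bar> < 1"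
    and n2: "0 \<le> t \<Longrightarrow> t \<le> 1 \<Longrightarrow> g2' t \<noteq> 0" and c2: "c1_on g2 g2' {0..1}" for t
    using A2 by (auto simp: long_arc_def)
  have half: "2 * t = 1" if "t * 2 = 1" for t :: real using that by simp
  have "c1_on g g' {0..1/2}"
    by (rule c1_on_cong[OF c1_on_affine[OF c1, of _ 2 0 0 "1/2"]]) (auto simp: g_def g'_def)
  moreover have "c1_on g g' {1/2..1}"
    by (rule c1_on_cong[OF c1_on_affine[OF c2, of _ 2 "-1" "1/2" "1/2"]])
      (auto simp: g_def g'_def e1 e2 antisym_conv half)
  ultimately have "c1_on g g' ({0..1/2} \<union> {1/2..1})" by (intro c1_on_Un) auto
  moreover have "{0..1/2} \<union> {1/2..1} = {0..1::real}" by auto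
  ultimately have C: "c1_on g g' {0..1}" by simp
  have lo: "0 < Re (g t) \<and> Re (g t) < 1/2 \<and> \<bar>Im (g t)\<bar> < 1" if "0 < t" "t < 1/2" for t
    using b1[of "2 * t"] that by (auto simp: g_def)
  have hi: "1/2 < Re (g t) \<and> Re (g t) < 1 \<and> \<bar>Im (g t)\<bar> < 1" if "1/2 < t" "t < 1" for t
    using b2[of "2 * t - 1"] that by (auto simp: g_def)
  have mid: "g (1/2) = 1/2" by (simp add: g_def e1)
  have "0 < Re (g t) \<and> Re (g t) < 1 \<and> \<bar>Im (g t)\<bar> < 1" if "0 < t" "t < 1" for t
  proof -
    consider "t < 1/2" | "t = 1/2" | "1/2 < t" by linarith
    then show ?thesis
    proof cases
      case 1
      then show ?thesis using lo[of t] that by simp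
    next
      case 2
      then show ?thesis unfolding 2 mid by simp
    next
      case 3
      then show ?thesis using hi[of t] that by simp
    qed
  qed
  then have LA: "long_arc g g'"
    unfolding long_arc_def using C n1 n2 e1 e2 by (auto simp: g_def g'_def)
  \<comment> \<open>Every property of the new arc is read off from this description of its double points.\<close>
  have D: "double_times g s t \<longleftrightarrow> (\<exists>s' t'. double_times g1 s' t' \<and> s = s' / 2 \<and> t = t' / 2) \<or>
     (\<exists>s' t'. double_times g2 s' t' \<and> s = (1 + s') / 2 \<and> t = (1 + t') / 2)" (is "_ \<longleftrightarrow> ?R1 \<or> ?R2") for s t
  proof
    assume d: "double_times g s t"
    then have st: "0 < s" "s < 1" "0 < t" "t < 1" "s \<noteq> t" "g s = g t" by (auto simp: double_times_def)
    have re: "Re (g s) = Re (g t)" using st by simp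
    have mid': "Re (g (1/2)) = 1/2" unfolding mid by simp
    have "(s < 1/2 \<and> t < 1/2) \<or> (1/2 < s \<and> 1/2 < t)"
      using lo[of s] lo[of t] hi[of s] hi[of t] mid' re st
      by (cases s "1/2 :: real" rule: linorder_cases; cases t "1/2 :: real" rule: linorder_cases) auto
    then show "?R1 \<or> ?R2"
    proof
      assume "s < 1/2 \<and> t < 1/2"
      then have "double_times g1 (2 * s) (2 * t)" using st by (auto simp: double_times_def g_def)
      then have ?R1 by (intro exI[of _ "2 * s"] exI[of _ "2 * t"]) auto
      then show ?thesis ..
    next
      assume "1/2 < s \<and> 1/2 < t"
      then have "double_times g2 (2 * s - 1) (2 * t - 1)" using st by (auto simp: double_times_def g_def)
      then have ?R2 by (intro exI[of _ "2 * s - 1"] exI[of _ "2 * t - 1"]) auto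
      then show ?thesis ..
    qed
  next
    assume "?R1 \<or> ?R2"
    then show "double_times g s t" by (auto simp: double_times_def g_def field_simps)
  qed
  have in1: "0 < s \<and> s < 1 \<and> 0 < t \<and> t < 1" if "double_times g1 s t" for s t using that by (auto simp: double_times_def)
  have in2: "0 < s \<and> s < 1 \<and> 0 < t \<and> t < 1" if "double_times g2 s t" for s t using that by (auto simp: double_times_def)
  have s1: "set ts1 = {t. \<exists>s. double_times g1 t s}" "sorted_wrt (<) ts1" using G1 by (auto simp: generic_arc_def)
  have s2: "set ts2 = {t. \<exists>s. double_times g2 t s}" "sorted_wrt (<) ts2" using G2 by (auto simp: generic_arc_def)
  have ts1: "0 < t \<and> t < 1" if "t \<in> set ts1" for t using that s1 in1 by auto
  have ts2: "0 < t \<and> t < 1" if "t \<in> set ts2" for t using that s2 in2 by auto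
  have sorted: "sorted_wrt (<) ts"
    unfolding ts_def sorted_wrt_append sorted_wrt_map
    using s1(2) s2(2) ts1 ts2 by (auto intro: sorted_wrt_mono_rel) fastforce
  have set: "set ts = {t. \<exists>s. double_times g t s}"
  proof (intro set_eqI)
    fix t
    have "t \<in> set ts \<longleftrightarrow> (\<exists>t'\<in>set ts1. t = t' / 2) \<or> (\<exists>t'\<in>set ts2. t = (1 + t') / 2)"
      by (auto simp: ts_def)
    also have "\<dots> \<longleftrightarrow> t \<in> {t. \<exists>s. double_times g t s}" unfolding s1(1) s2(1) D by blast
    finally show "t \<in> set ts \<longleftrightarrow> t \<in> {t. \<exists>s. double_times g t s}" .
  qed
  have u1: "t = u" if "double_times g1 s t" "double_times g1 s u" for s t u
    using G1 that unfolding generic_arc_def by blast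
  have u2: "t = u" if "double_times g2 s t" "double_times g2 s u" for s t u
    using G2 that unfolding generic_arc_def by blast
  have sep: False if "double_times g1 s t" "double_times g2 s' t'" "s = 1 + s'" for s t s' t'
    using in1[OF that(1)] in2[OF that(2)] that(3) by simp
  have uniq: "t = u" if "double_times g s t" "double_times g s u" for s t u
    using that unfolding D by (auto dest: u1 u2 sep)
  have ov: "ov (t / 2) = ov1 t" "g' (t / 2) = g1' t" if "t < 1" for t using that by (auto simp: ov_def g'_def)
  have ov': "ov ((1 + t) / 2) = ov2 t" "g' ((1 + t) / 2) = g2' t" if "0 < t" for t
  proof -
    have "\<not> (1 + t) / 2 \<le> 1/2" "2 * ((1 + t) / 2) - 1 = t" using that by (auto simp: field_simps)
    then show "ov ((1 + t) / 2) = ov2 t" "g' ((1 + t) / 2) = g2' t" unfolding ov_def g'_def by presburger+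
  qed
  have x1: "Im (cnj (g1' s) * g1' t) \<noteq> 0 \<and> ov1 s \<noteq> ov1 t" if "double_times g1 s t" for s t
    using G1 that unfolding generic_arc_def by blast
  have x2: "Im (cnj (g2' s) * g2' t) \<noteq> 0 \<and> ov2 s \<noteq> ov2 t" if "double_times g2 s t" for s t
    using G2 that unfolding generic_arc_def by blast
  have tr: "Im (cnj (g' s) * g' t) \<noteq> 0 \<and> ov s \<noteq> ov t" if "double_times g s t" for s t
    using that unfolding D
  proof (elim disjE exE conjE)
    fix s' t' assume a: "double_times g1 s' t'" "s = s' / 2" "t = t' / 2"
    show ?thesis unfolding a(2,3) using x1[OF a(1)] in1[OF a(1)] ov[of s'] ov[of t'] by simp
  next
    fix s' t' assume a: "double_times g2 s' t'" "s = (1 + s') / 2" "t = (1 + t') / 2"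
    show ?thesis unfolding a(2,3) using x2[OF a(1)] in2[OF a(1)] ov'[of s'] ov'[of t'] by simp
  qed
  have GA: "generic_arc g g' ov ts" unfolding generic_arc_def using sorted set uniq tr by blast
  have "map ov (map (\<lambda>t. t / 2) ts1) = map ov1 ts1" "map ov (map (\<lambda>t. (1 + t) / 2) ts2) = map ov2 ts2"
    using ts1 ts2 ov ov' by auto
  then have W: "map ov ts = w1 @ w2" unfolding ts_def map_append w1 w2 by simp
  have UF: "under_first g ov = (\<lambda>t. t / 2) ` under_first g1 ov1 \<union> (\<lambda>t. (1 + t) / 2) ` under_first g2 ov2"
  proof (intro set_eqI iffI)
    fix t assume "t \<in> under_first g ov"
    then obtain s where s: "t < s" "double_times g t s" "\<not> ov t" unfolding under_first_def by blast
    from s(2) show "t \<in> (\<lambda>t. t / 2) ` under_first g1 ov1 \<union> (\<lambda>t. (1 + t) / 2) ` under_first g2 ov2"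
      unfolding D
    proof (elim disjE exE conjE)
      fix t' s' assume a: "double_times g1 t' s'" "t = t' / 2" "s = s' / 2"
      have "\<not> ov1 t'" using s(3) ov(1)[of t'] in1[OF a(1)] unfolding a(2) by blast
      moreover have "t' < s'" using s(1) unfolding a(2,3) by simp
      ultimately have "t' \<in> under_first g1 ov1" using a(1) unfolding under_first_def by blast
      then show ?thesis unfolding a(2) by blast
    next
      fix t' s' assume a: "double_times g2 t' s'" "t = (1 + t') / 2" "s = (1 + s') / 2"
      have "\<not> ov2 t'" using s(3) ov'(1)[of t'] in2[OF a(1)] unfolding a(2) by blast
      moreover have "t' < s'" using s(1) unfolding a(2,3) by simp
      ultimately have "t' \<in> under_first g2 ov2" using a(1) unfolding under_first_def by blast
      then show ?thesis unfolding a(2) by blast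
    qed
  next
    fix t assume "t \<in> (\<lambda>t. t / 2) ` under_first g1 ov1 \<union> (\<lambda>t. (1 + t) / 2) ` under_first g2 ov2"
    then show "t \<in> under_first g ov"
    proof
      assume "t \<in> (\<lambda>t. t / 2) ` under_first g1 ov1"
      then obtain t' s' where a: "t = t' / 2" "\<not> ov1 t'" "t' < s'" "double_times g1 t' s'"
        unfolding under_first_def by blast
      have "double_times g t (s' / 2)" unfolding D using a by blast
      moreover have "\<not> ov t" using ov(1)[of t'] in1[OF a(4)] a(2) unfolding a(1) by blast
      ultimately have "\<not> ov t \<and> s' / 2 > t \<and> double_times g t (s' / 2)" using a(3) unfolding a(1) by simp
      then show ?thesis unfolding under_first_def by blast
    next
      assume "t \<in> (\<lambda>t. (1 + t) / 2) ` under_first g2 ov2"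
      then obtain t' s' where a: "t = (1 + t') / 2" "\<not> ov2 t'" "t' < s'" "double_times g2 t' s'"
        unfolding under_first_def by blast
      have "double_times g t ((1 + s') / 2)" unfolding D using a by blast
      moreover have "\<not> ov t" using ov'(1)[of t'] in2[OF a(4)] a(2) unfolding a(1) by blast
      ultimately have "\<not> ov t \<and> (1 + s') / 2 > t \<and> double_times g t ((1 + s') / 2)" using a(3) unfolding a(1) by simp
      then show ?thesis unfolding under_first_def by blast
    qed
  qed
  have "card (under_first g ov) = card ((\<lambda>t. t / 2) ` under_first g1 ov1) + card ((\<lambda>t. (1 + t) / 2) ` under_first g2 ov2)"
    unfolding UF
    using finite_under_first[OF G1] finite_under_first[OF G2]
    by (intro card_Un_disjoint) (auto simp: under_first_def dest: sep)
  also have "\<dots> = k1 + k2" using k1 k2 by (simp add: card_image inj_on_def)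
  finally show ?thesis unfolding realizable_def using LA GA W by blast
qed

section \<open>Wrapping a loop around an arc\<close>

definition smoothstep :: "real \<Rightarrow> real" where
  "smoothstep x = 3 * x^2 - 2 * x^3"

lemma smoothstep_strict_mono:
  assumes "0 \<le> x" "x < y" "y \<le> 1"
  shows "smoothstep x < smoothstep y"
proof -
  have "smoothstep y - smoothstep x
      = (y - x) * (2 * (x * (1 - x)) + 2 * (y * (1 - y)) + x * (1 - y) + y * (1 - x))"
    by (simp add: smoothstep_def power2_eq_square power3_eq_cube algebra_simps)
  moreover have "2 * (x * (1 - x)) + 2 * (y * (1 - y)) + x * (1 - y) + y * (1 - x) > 0"
    using assms by (intro add_nonneg_pos add_nonneg_nonneg mult_nonneg_nonneg mult_pos_pos) auto
  ultimately show ?thesis using assms by (metis diff_gt_0_iff_gt mult_pos_pos)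
qed

text \<open>
  The first part of a kink, run through for times from \<open>0\<close> to \<open>14/33\<close>.  It starts at \<open>0\<close> to the right
  and rises all the time; it passes the axis \<open>Re z = 1/2\<close> at time \<open>4/11\<close>, turns around at time \<open>40/99\<close>,
  and arrives at the top of the loop moving horizontally to the left with speed \<open>1/8\<close>.  The factor
  \<open>99/32\<close> makes both times at which the parabola meets the axis rational; the second one, \<open>4/9\<close>, is
  later than \<open>14/33\<close>.
\<close>

definition entry :: "real \<Rightarrow> complex" where
  "entry s = Complex (5/2 * s - 99/32 * s^2) (smoothstep (33/14 * s) / 2)"

definition entry' :: "real \<Rightarrow> complex" where
  "entry' s = Complex (5/2 - 99/16 * s) (99/14 * (33/14 * s) * (1 - 33/14 * s))"

lemma Re_entry_half: "Re (entry s) - 1/2 = - (99/32) * ((s - 4/11) * (s - 4/9))"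
  by (simp add: entry_def power2_eq_square algebra_simps)

lemma Re_entry_end: "Re (entry s) - (1/2 + 1/264) = - (99/32) * ((s - 38/99) * (s - 14/33))"
  by (simp add: entry_def power2_eq_square field_simps)

lemma entry_ends: "entry 0 = 0" "entry (14/33) = Complex (1/2 + 1/264) (1/2)"
  "entry' 0 = 5/2" "entry' (14/33) = - 1/8"
  by (auto simp: entry_def entry'_def smoothstep_def complex_eq_iff power2_eq_square power3_eq_cube)

lemma c1_on_entry: "c1_on entry entry' S"
  unfolding c1_on_def entry_def entry'_def smoothstep_def
  by (auto intro!: derivative_eq_intros continuous_intros
      simp: has_vector_derivative_complex_iff power2_eq_square power3_eq_cube field_simps)

lemma Im_entry_strict_mono:
  assumes "0 \<le> s" "s < t" "t \<le> 14/33"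
  shows "Im (entry s) < Im (entry t)"
  using smoothstep_strict_mono[of "33/14 * s" "33/14 * t"] assms by (simp add: entry_def)

lemma entry_crossing:
  assumes "s \<le> 14/33" "Re (entry s) = 1/2"
  shows "s = 4/11"
  using Re_entry_half[of s] assms by auto

text \<open>
  The inserted arc occupies the box of half-width \<open>1/264\<close> and half-height \<open>1/132\<close> around the top of the
  loop.  The real part of the entry is in the range of this box, or to the left of it, only before time
  \<open>38/99\<close>, and up to that time the entry is below the box.
\<close>

lemma entry_low:
  assumes "0 \<le> s" "s \<le> 14/33" "Re (entry s) < 1/2 + 1/264"
  shows "Im (entry s) < 1/2 - 1/132"
proof -
  have "s < 38/99"
  proof (rule ccontr)
    assume "\<not> s < 38/99"
    then have "(s - 38/99) * (s - 14/33) \<le> 0" using assms by (intro mult_nonneg_nonpos) auto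
    then show False using Re_entry_end[of s] assms by linarith
  qed
  then have "Im (entry s) < Im (entry (38/99))" using assms by (intro Im_entry_strict_mono) auto
  also have "\<dots> < 1/2 - 1/132" by (simp add: entry_def smoothstep_def power2_eq_square power3_eq_cube)
  finally show ?thesis .
qed

lemma entry_range:
  assumes "0 < s" "s \<le> 14/33"
  shows "0 < Re (entry s)" "Re (entry s) < 1" "0 < Im (entry s)" "Im (entry s) \<le> 1/2"
proof -
  have "Re (entry s) = s * (5/2 - 99/32 * s)" by (simp add: entry_def power2_eq_square algebra_simps)
  moreover have "5/2 - 99/32 * s > 0" using assms by simp
  ultimately show "0 < Re (entry s)" using assms by (metis mult_pos_pos)
  have "Re (entry s) = 50/99 - 99/32 * (s - 40/99)^2"
    by (simp add: entry_def power2_eq_square field_simps)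
  moreover have "(s - 40/99)^2 \<ge> 0" by simp
  ultimately show "Re (entry s) < 1" by linarith
  show "0 < Im (entry s)" using Im_entry_strict_mono[of 0 s] assms by (simp add: entry_ends)
  show "Im (entry s) \<le> 1/2"
  proof (cases "s = 14/33")
    case True
    show ?thesis unfolding True entry_ends(2) by simp
  next
    case False
    then have "Im (entry s) < Im (entry (14/33))" using assms by (intro Im_entry_strict_mono) auto
    then show ?thesis unfolding entry_ends(2) by simp
  qed
qed

lemma entry'_nonzero:
  assumes "0 \<le> s" "s \<le> 14/33"
  shows "entry' s \<noteq> 0"
proof
  assume "entry' s = 0"
  then have "s = 40/99" "s = 0 \<or> s = 14/33" by (auto simp: entry'_def complex_eq_iff)
  then show False by auto
qed

text \<open>
  The kink consists of \<open>entry\<close>, of a copy of the given arc shrunk by the factor \<open>1/132\<close> and rotated by a half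
  turn along the top of the loop, and of the mirror image of \<open>entry\<close> run backwards.  The time that is
  left for the copy is \<open>5/33\<close>; it thus starts and ends with velocity
  \<open>- (1/132) * (33/5) * (5/2) = - 1/8\<close>, as the entry requires.  The imaginary part is strictly
  increasing along the entry, so the entry meets its mirror image only on the axis of symmetry, at
  time \<open>4/11\<close>.  Hence the kink has exactly one crossing of its own, passed before and after the copy.
\<close>

lemma realizable_wrap:
  assumes "realizable w k"
  shows "realizable (b # w @ [\<not> b]) (k + (if b then 0 else 1))"
proof -
  from assms obtain g0 g0' ov0 ts0 where
    A0: "long_arc g0 g0'" and G0: "generic_arc g0 g0' ov0 ts0" and w: "map ov0 ts0 = w"
    and k: "card (under_first g0 ov0) = k"
    unfolding realizable_def by blast
  have e0: "g0 0 = 0" "g0 1 = 1" "g0' 0 = 5/2" "g0' 1 = 5/2"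
    and b0: "\<And>t. 0 < t \<Longrightarrow> t < 1 \<Longrightarrow> 0 < Re (g0 t) \<and> Re (g0 t) < 1 \<and> \<bar>Im (g0 t)\<bar> < 1"
    and n0: "\<And>t. 0 \<le> t \<Longrightarrow> t \<le> 1 \<Longrightarrow> g0' t \<noteq> 0" and c0: "c1_on g0 g0' {0..1}"
    using A0 by (auto simp: long_arc_def)
  \<comment> \<open>Times of the copy of the given arc are translated by \<open>loc\<close> into times of that arc, and back by \<open>glob\<close>.\<close>
  define loc :: "real \<Rightarrow> real" where "loc t = 33/5 * t + (- 14/5)" for t
  define glob :: "real \<Rightarrow> real" where "glob u = 14/33 + 5/33 * u" for u
  have loc_glob: "loc (glob u) = u" "glob (loc t) = t" for u t
    by (simp_all add: loc_def glob_def field_simps)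
  have glob_less: "glob u < glob v \<longleftrightarrow> u < v" and glob_inj: "glob u = glob v \<longleftrightarrow> u = v" for u v
    by (simp_all add: glob_def)
  have glob_in: "14/33 < glob u \<and> glob u < 19/33 \<longleftrightarrow> 0 < u \<and> u < 1" for u
    by (auto simp: glob_def)
  have loc_in: "0 < loc t \<and> loc t < 1 \<longleftrightarrow> 14/33 < t \<and> t < 19/33" for t
    by (auto simp: loc_def)
  define top where "top t = Complex (1/2 + 1/264) (1/2) + (- 1/132) * g0 (loc t)" for t
  define top' where "top' t = (- 1/132) * (33/5 * g0' (loc t))" for t
  define out where "out t = 1 - cnj (entry (1 - t))" for t
  define out' where "out' t = cnj (entry' (1 - t))" for t
  define g where "g t = (if t \<le> 14/33 then entry t else if t < 19/33 then top t else out t)" for t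
  define g' where "g' t = (if t \<le> 14/33 then entry' t else if t < 19/33 then top' t else out' t)" for t
  define ov where "ov t = (if t \<le> 14/33 then b else if t < 19/33 then ov0 (loc t) else \<not> b)" for t
  define ts where "ts = 4/11 # map glob ts0 @ [7/11]"
  have g_lo: "g t = entry t" "g' t = entry' t" "ov t = b" if "t \<le> 14/33" for t
    using that by (simp_all add: g_def g'_def ov_def)
  have g_mid: "g t = top t" "g' t = top' t" "ov t = ov0 (loc t)" if "14/33 < t" "t < 19/33" for t
    using that by (simp_all add: g_def g'_def ov_def)
  have g_hi: "g t = out t" "g' t = out' t" "ov t = (\<not> b)" if "19/33 \<le> t" for t
    using that by (simp_all add: g_def g'_def ov_def)
  have joint1: "top (14/33) = entry (14/33)" "top' (14/33) = entry' (14/33)"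
    by (simp_all add: top_def top'_def loc_def e0 entry_ends)
  have joint2: "top (19/33) = out (19/33)" "top' (19/33) = out' (19/33)"
    by (simp_all add: top_def top'_def out_def out'_def loc_def e0 entry_ends complex_eq_iff)

  have "c1_on g g' {0..14/33}"
    by (rule c1_on_cong[OF c1_on_entry]) (auto simp: g_lo)
  moreover have "c1_on g g' {14/33..19/33}"
  proof (rule c1_on_cong)
    show "c1_on top top' {14/33..19/33}"
      unfolding top_def top'_def loc_def
      using c1_on_affine[OF c0, of "{14/33..19/33}" "33/5" "- 14/5" "Complex (1/2 + 1/264) (1/2)" "- 1/132"]
      by simp
    fix t :: real assume "t \<in> {14/33..19/33}"
    then consider "t = 14/33" | "14/33 < t" "t < 19/33" | "t = 19/33" by fastforce
    then have "g t = top t \<and> g' t = top' t"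
    proof cases
      case 1
      show ?thesis unfolding 1 joint1 using g_lo[of "14/33"] by simp
    next
      case 2
      then show ?thesis using g_mid[of t] by simp
    next
      case 3
      show ?thesis unfolding 3 joint2 using g_hi[of "19/33"] by simp
    qed
    then show "g t = top t" "g' t = top' t" by auto
  qed
  moreover have "c1_on g g' {19/33..1}"
  proof (rule c1_on_cong)
    show "c1_on out out' {19/33..1}"
      unfolding c1_on_def
    proof (intro conjI ballI)
      fix t :: real assume t: "t \<in> {19/33..1}"
      have "c1_on (\<lambda>t. 0 + 1 * entry (- 1 * t + 1)) (\<lambda>t. 1 * ((- 1) * entry' (- 1 * t + 1))) {19/33..1}"
        using c1_on_affine[OF c1_on_entry[of UNIV], where a = "- 1" and b = 1 and z = 0 and w = 1] by simp
      then have "c1_on (\<lambda>t. entry (1 - t)) (\<lambda>t. - entry' (1 - t)) {19/33..1}" by simp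
      with t have "((\<lambda>t. entry (1 - t)) has_vector_derivative - entry' (1 - t)) (at t within {19/33..1})"
        by (simp add: c1_on_def)
      then have "((\<lambda>t. Re (entry (1 - t))) has_real_derivative - Re (entry' (1 - t))) (at t within {19/33..1})"
        and im: "((\<lambda>t. Im (entry (1 - t))) has_real_derivative - Im (entry' (1 - t))) (at t within {19/33..1})"
        by (auto simp: has_vector_derivative_complex_iff)
      from DERIV_diff[OF DERIV_const[of 1] this(1)] im
      show "(out has_vector_derivative out' t) (at t within {19/33..1})"
        unfolding out_def out'_def has_vector_derivative_complex_iff by simp
    next
      have "continuous_on {19/33..1} (\<lambda>t. entry' (1 - t))"
        by (rule continuous_on_compose2[of UNIV entry']) (use c1_on_entry[of UNIV] in \<open>auto simp: c1_on_def intro!: continuous_intros\<close>)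
      then show "continuous_on {19/33..1} out'" unfolding out'_def by (intro continuous_intros)
    qed
  qed (auto simp: g_hi)
  ultimately have "c1_on g g' (({0..14/33} \<union> {14/33..19/33}) \<union> {19/33..1})"
    by (intro c1_on_Un) auto
  moreover have "({0..14/33} \<union> {14/33..19/33}) \<union> {19/33..1} = {0..1::real}" by auto
  ultimately have C: "c1_on g g' {0..1}" by simp

  have top_box: "1/2 - 1/264 < Re (top t)" "Re (top t) < 1/2 + 1/264"
    "1/2 - 1/132 < Im (top t)" "Im (top t) < 1/2 + 1/132" if "14/33 < t" "t < 19/33" for t
    using b0[of "loc t"] that loc_in[of t] by (auto simp: top_def abs_less_iff)
  have Re_out: "Re (out t) = 1 - Re (entry (1 - t))" and Im_out: "Im (out t) = Im (entry (1 - t))" for t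
    by (simp_all add: out_def)
  have cases3: "(0 < t \<and> t \<le> 14/33) \<or> (14/33 < t \<and> t < 19/33) \<or> (19/33 \<le> t \<and> t < 1)"
    if "0 < t" "t < 1" for t :: real using that by auto
  have box: "0 < Re (g t) \<and> Re (g t) < 1 \<and> \<bar>Im (g t)\<bar> < 1" if "0 < t" "t < 1" for t
    using cases3[OF that]
  proof (elim disjE conjE)
    assume "0 < t" "t \<le> 14/33"
    then show ?thesis using entry_range[of t] g_lo[of t] by auto
  next
    assume "14/33 < t" "t < 19/33"
    then show ?thesis using top_box[of t] g_mid[of t] by auto
  next
    assume "19/33 \<le> t" "t < 1"
    then show ?thesis using entry_range[of "1 - t"] g_hi[of t] Re_out[of t] Im_out[of t] by auto
  qed
  have nz: "g' t \<noteq> 0" if "0 \<le> t" "t \<le> 1" for t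
  proof -
    consider "t \<le> 14/33" | "14/33 < t" "t < 19/33" | "19/33 \<le> t" by linarith
    then show ?thesis
    proof cases
      case 1
      then show ?thesis using entry'_nonzero[of t] g_lo[of t] that by simp
    next
      case 2
      then show ?thesis using n0[of "loc t"] loc_in[of t] g_mid[of t] by (simp add: top'_def)
    next
      case 3
      then show ?thesis using entry'_nonzero[of "1 - t"] g_hi[of t] that by (simp add: out'_def)
    qed
  qed
  have LA: "long_arc g g'"
    unfolding long_arc_def using C box nz
    by (auto simp: g_lo g_hi out_def out'_def entry_ends)

  have entry_inj: "s = t" if "0 < s" "s \<le> 14/33" "0 < t" "t \<le> 14/33" "Im (entry s) = Im (entry t)" for s t
    using Im_entry_strict_mono[of s t] Im_entry_strict_mono[of t s] that
    by (cases s t rule: linorder_cases) auto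
  have D_less: "(\<exists>s' t'. double_times g0 s' t' \<and> s = glob s' \<and> t = glob t') \<or> (s = 4/11 \<and> t = 7/11)"
    if "double_times g s t" "s < t" for s t
  proof -
    have st: "0 < s" "s < 1" "0 < t" "t < 1" "s < t" "g s = g t" using that by (auto simp: double_times_def)
    from cases3[OF st(1,2)] show ?thesis
    proof (elim disjE conjE)
      assume s: "0 < s" "s \<le> 14/33"
      from cases3[OF st(3,4)] show ?thesis
      proof (elim disjE conjE)
        assume t: "0 < t" "t \<le> 14/33"
        then show ?thesis using entry_inj[OF s t] st g_lo(1)[of s] g_lo(1)[of t] by auto
      next
        assume t: "14/33 < t" "t < 19/33"
        have "entry s = top t" using st(6) g_lo(1)[of s] g_mid(1)[of t] s t by simp
        then show ?thesis using entry_low[of s] top_box[OF t] s by auto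
      next
        assume t: "19/33 \<le> t" "t < 1"
        have eq: "entry s = out t" using st(6) g_lo(1)[of s] g_hi(1)[of t] s t by simp
        then have "Im (entry s) = Im (entry (1 - t))" using Im_out[of t] by simp
        then have s1: "s = 1 - t" using entry_inj[of s "1 - t"] s t by auto
        then have "Re (entry s) = 1/2" using eq Re_out[of t] by simp
        then show ?thesis using entry_crossing[of s] s s1 by auto
      qed
    next
      assume s: "14/33 < s" "s < 19/33"
      from cases3[OF st(3,4)] show ?thesis
      proof (elim disjE conjE)
        assume "0 < t" "t \<le> 14/33"
        then show ?thesis using s st by auto
      next
        assume t: "14/33 < t" "t < 19/33"
        have "top s = top t" using st(6) g_mid(1)[of s] g_mid(1)[of t] s t by simp
        then have "g0 (loc s) = g0 (loc t)" by (simp add: top_def)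
        moreover have "loc s \<noteq> loc t" using st(5) by (simp add: loc_def)
        ultimately have "double_times g0 (loc s) (loc t)"
          using loc_in[of s] loc_in[of t] s t by (simp add: double_times_def)
        then show ?thesis using loc_glob(2) by metis
      next
        assume t: "19/33 \<le> t" "t < 1"
        have "out t = top s" using st(6) g_mid(1)[of s] g_hi(1)[of t] s t by simp
        then show ?thesis using entry_low[of "1 - t"] top_box[OF s] t Re_out[of t] Im_out[of t] by auto
      qed
    next
      assume s: "19/33 \<le> s" "s < 1"
      then have t: "19/33 \<le> t" "t < 1" using st by auto
      have "Im (entry (1 - s)) = Im (entry (1 - t))"
        using st(6) g_hi(1)[of s] g_hi(1)[of t] s t Im_out[of s] Im_out[of t] by simp
      then show ?thesis using entry_inj[of "1 - s" "1 - t"] s t st by auto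
    qed
  qed
  have kink: "double_times g (4/11) (7/11)"
  proof -
    have "g (4/11) = entry (4/11)" "g (7/11) = out (7/11)" using g_lo(1)[of "4/11"] g_hi(1)[of "7/11"] by auto
    moreover have "Re (entry (4/11)) = 1/2" using Re_entry_half[of "4/11"] by simp
    ultimately show ?thesis unfolding double_times_def by (simp add: out_def complex_eq_iff)
  qed
  have inner: "double_times g (glob s) (glob t)" if "double_times g0 s t" for s t
  proof -
    have st: "0 < s" "s < 1" "0 < t" "t < 1" "s \<noteq> t" "g0 s = g0 t" using that by (auto simp: double_times_def)
    have "14/33 < glob s" "glob s < 19/33" "14/33 < glob t" "glob t < 19/33"
      using glob_in st by auto
    then show ?thesis
      using g_mid(1)[of "glob s"] g_mid(1)[of "glob t"] glob_inj[of s t] st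
      by (auto simp: double_times_def top_def loc_glob)
  qed
  have D: "double_times g s t \<longleftrightarrow> (\<exists>s' t'. double_times g0 s' t' \<and> s = glob s' \<and> t = glob t') \<or>
     (s = 4/11 \<and> t = 7/11) \<or> (s = 7/11 \<and> t = 4/11)" for s t
  proof
    assume d: "double_times g s t"
    then have "s < t \<or> t < s" by (auto simp: double_times_def)
    then show "(\<exists>s' t'. double_times g0 s' t' \<and> s = glob s' \<and> t = glob t') \<or>
     (s = 4/11 \<and> t = 7/11) \<or> (s = 7/11 \<and> t = 4/11)"
    proof
      assume "s < t"
      then show ?thesis using D_less[OF d] by blast
    next
      assume "t < s"
      then show ?thesis using D_less[OF d[unfolded double_times_sym[of g s t]]] double_times_sym by blast
    qed
  qed (use kink inner double_times_sym in blast)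
  have in0: "0 < s \<and> s < 1 \<and> 0 < t \<and> t < 1" if "double_times g0 s t" for s t using that by (auto simp: double_times_def)
  have mids: "14/33 < glob s" "glob s < 19/33" if "double_times g0 s t" for s t
    using in0[OF that] glob_in[of s] by auto
  have s0: "set ts0 = {t. \<exists>s. double_times g0 t s}" "sorted_wrt (<) ts0" using G0 by (auto simp: generic_arc_def)
  have gl: "4/11 < glob t \<and> glob t < 7/11" if "t \<in> set ts0" for t
    using that mids unfolding s0(1) by force
  have sorted: "sorted_wrt (<) ts"
    unfolding ts_def using s0(2) gl by (auto simp: sorted_wrt_append sorted_wrt_map glob_less)
  have set: "set ts = {t. \<exists>s. double_times g t s}"
  proof (intro set_eqI)
    fix t
    have "t \<in> set ts \<longleftrightarrow> t = 4/11 \<or> t = 7/11 \<or> (\<exists>t'\<in>set ts0. t = glob t')"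
      by (auto simp: ts_def)
    also have "\<dots> \<longleftrightarrow> t \<in> {t. \<exists>s. double_times g t s}" unfolding s0(1) D by blast
    finally show "t \<in> set ts \<longleftrightarrow> t \<in> {t. \<exists>s. double_times g t s}" .
  qed
  have u0: "t = u" if "double_times g0 s t" "double_times g0 s u" for s t u
    using G0 that unfolding generic_arc_def by blast
  have uniq: "t = u" if "double_times g s t" "double_times g s u" for s t u
    using that unfolding D
  proof (elim disjE exE conjE)
    fix s' t' s'' t'' assume "double_times g0 s' t'" "s = glob s'" "t = glob t'" "double_times g0 s'' t''" "s = glob s''" "u = glob t''"
    then show ?thesis using u0[of s' t' t''] glob_inj[of s' s''] by simp
  qed (use mids in force)+
  have x0: "Im (cnj (g0' s) * g0' t) \<noteq> 0 \<and> ov0 s \<noteq> ov0 t" if "double_times g0 s t" for s t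
    using G0 that unfolding generic_arc_def by blast
  \<comment> \<open>At the crossing, the two velocities are complex conjugates of each other.\<close>
  have entry'_kink: "Re (entry' (4/11)) \<noteq> 0" "Im (entry' (4/11)) \<noteq> 0" by (simp_all add: entry'_def)
  have gk: "g' (4/11) = entry' (4/11)" "g' (7/11) = cnj (entry' (4/11))" "ov (4/11) = b" "ov (7/11) = (\<not> b)"
    using g_lo[of "4/11"] g_hi[of "7/11"] by (auto simp: out'_def)
  have tr: "Im (cnj (g' s) * g' t) \<noteq> 0 \<and> ov s \<noteq> ov t" if "double_times g s t" for s t
    using that unfolding D
  proof (elim disjE exE conjE)
    fix s' t' assume a: "double_times g0 s' t'" "s = glob s'" "t = glob t'"
    have a': "double_times g0 t' s'" using a(1) double_times_sym by blast
    have prod: "cnj (g' s) * g' t = of_real (1/400) * (cnj (g0' s') * g0' t')"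
      unfolding a(2,3) g_mid(2)[OF mids[OF a(1)]] g_mid(2)[OF mids[OF a']] top'_def loc_glob by simp
    have scale: "Im (of_real (1/400) * z) = 1/400 * Im z" for z by simp
    have "Im (cnj (g' s) * g' t) = 1/400 * Im (cnj (g0' s') * g0' t')" unfolding prod scale ..
    moreover have "ov s = ov0 s'" "ov t = ov0 t'"
      unfolding a(2,3) g_mid(3)[OF mids[OF a(1)]] g_mid(3)[OF mids[OF a']] loc_glob by auto
    ultimately show ?thesis using x0[OF a(1)] by simp
  next
    assume a: "s = 4/11" "t = 7/11"
    show ?thesis unfolding a gk using entry'_kink by simp
  next
    assume a: "s = 7/11" "t = 4/11"
    show ?thesis unfolding a gk using entry'_kink by simp
  qed
  have GA: "generic_arc g g' ov ts" unfolding generic_arc_def using sorted set uniq tr by blast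
  have "ov (glob t) = ov0 t" if t: "t \<in> set ts0" for t
  proof -
    obtain s where "double_times g0 t s" using t unfolding s0(1) by blast
    then show ?thesis using g_mid(3)[OF mids] loc_glob(1) by simp
  qed
  then have W: "map ov ts = b # w @ [\<not> b]" unfolding ts_def w[symmetric] using gk by simp
  have UF: "under_first g ov = glob ` under_first g0 ov0 \<union> (if b then {} else {4/11})"
  proof (intro set_eqI iffI)
    fix t assume "t \<in> under_first g ov"
    then obtain s where s: "t < s" "double_times g t s" "\<not> ov t" unfolding under_first_def by blast
    from s(2) show "t \<in> glob ` under_first g0 ov0 \<union> (if b then {} else {4/11})"
      unfolding D
    proof (elim disjE exE conjE)
      fix t' s' assume a: "double_times g0 t' s'" "t = glob t'" "s = glob s'"
      have "\<not> ov0 t'" using s(3) unfolding a(2) g_mid(3)[OF mids[OF a(1)]] loc_glob .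
      moreover have "t' < s'" using s(1) unfolding a(2,3) glob_less .
      ultimately have "t' \<in> under_first g0 ov0" using a(1) unfolding under_first_def by blast
      then show ?thesis unfolding a(2) by blast
    next
      assume a: "t = 4/11" "s = 7/11"
      show ?thesis using s(3) unfolding a gk by simp
    next
      assume "t = 7/11" "s = 4/11"
      then show ?thesis using s(1) by simp
    qed
  next
    fix t assume "t \<in> glob ` under_first g0 ov0 \<union> (if b then {} else {4/11})"
    then show "t \<in> under_first g ov"
    proof
      assume "t \<in> glob ` under_first g0 ov0"
      then obtain t' s' where a: "t = glob t'" "\<not> ov0 t'" "t' < s'" "double_times g0 t' s'"
        unfolding under_first_def by blast
      have "\<not> ov t" using a(2) unfolding a(1) g_mid(3)[OF mids[OF a(4)]] loc_glob .
      moreover have "glob s' > t" using a(3) unfolding a(1) glob_less .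
      ultimately show ?thesis using inner[OF a(4)] unfolding a(1) under_first_def by blast
    next
      assume "t \<in> (if b then {} else {4/11})"
      then have t: "t = 4/11" and b: "\<not> b" by (auto split: if_splits)
      have "\<not> ov t \<and> 7/11 > t \<and> double_times g t (7/11)" using gk(3) b kink unfolding t by simp
      then show ?thesis unfolding under_first_def by blast
    qed
  qed
  have "4/11 \<notin> glob ` under_first g0 ov0" using mids by (force simp: under_first_def)
  moreover have "card (glob ` under_first g0 ov0) = k"
    using k by (simp add: card_image inj_on_def glob_inj)
  ultimately have K: "card (under_first g ov) = k + (if b then 0 else 1)"
    unfolding UF using finite_under_first[OF G0] by simp
  show ?thesis unfolding realizable_def
    by (intro exI[of _ g] exI[of _ g'] exI[of _ ov] exI[of _ ts] conjI LA GA W K)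
qed

section \<open>Closing a long arc on the sphere\<close>

definition vec3 :: "real \<Rightarrow> real \<Rightarrow> real \<Rightarrow> real ^ 3" where
  "vec3 a b c = a *\<^sub>R axis 1 1 + b *\<^sub>R axis 2 1 + c *\<^sub>R axis 3 1"

lemma vec3_nth [simp]: "vec3 a b c $ 1 = a" "vec3 a b c $ 2 = b" "vec3 a b c $ 3 = c"
  by (simp_all add: vec3_def axis_def)

lemma vec3_has_vector_derivative:
  assumes "(a has_real_derivative a') F" "(b has_real_derivative b') F" "(c has_real_derivative c') F"
  shows "((\<lambda>t. vec3 (a t) (b t) (c t)) has_vector_derivative vec3 a' b' c') F"
  unfolding vec3_def
  using assms unfolding has_real_derivative_iff_has_vector_derivative
  by (intro has_vector_derivative_add bounded_linear.has_vector_derivative[OF bounded_linear_scaleR_left])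

definition recip_norm :: "real \<Rightarrow> real" where
  "recip_norm y = 1 / sqrt (1 + y\<^sup>2)"

lemma recip_norm_pos: "recip_norm y > 0"
  by (simp add: recip_norm_def add_pos_nonneg)

lemma recip_norm_sq: "(recip_norm y)\<^sup>2 * (1 + y\<^sup>2) = 1"
proof -
  have "1 + y\<^sup>2 > 0" by (simp add: add_pos_nonneg)
  then show ?thesis by (simp add: recip_norm_def power_divide)
qed

lemma recip_norm_deriv:
  assumes "(y has_real_derivative y') (at t within S)"
  shows "((\<lambda>t. recip_norm (y t)) has_real_derivative - (y t * y' * recip_norm (y t) ^ 3)) (at t within S)"
proof -
  have pos: "1 + (y t)\<^sup>2 > 0" by (simp add: add_pos_nonneg)
  have "((\<lambda>t. sqrt (1 + (y t)\<^sup>2)) has_real_derivative (2 * y t * y') * (inverse (sqrt (1 + (y t)\<^sup>2)) / 2)) (at t within S)"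
    using pos by (auto intro!: derivative_eq_intros assms)
  then have "((\<lambda>t. inverse (sqrt (1 + (y t)\<^sup>2))) has_real_derivative
      - (inverse (sqrt (1 + (y t)\<^sup>2)) * ((2 * y t * y') * (inverse (sqrt (1 + (y t)\<^sup>2)) / 2)) * inverse (sqrt (1 + (y t)\<^sup>2)))) (at t within S)"
    using pos by (intro DERIV_inverse') auto
  moreover have "- (q * ((2 * a * b) * (q / 2)) * q) = - (a * b * q ^ 3)" for q a b :: real
    by (simp add: power3_eq_cube)
  ultimately show ?thesis unfolding recip_norm_def divide_inverse mult_1_left by (rule DERIV_cong)
qed

text \<open>
  The vertical cylinder over the unit circle is projected radially onto the sphere, after the strip
  \<open>0 \<le> Re z \<le> 1\<close> has been wrapped around it.  An arc from \<open>0\<close> to \<open>1\<close> with equal end velocities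
  thus becomes a closed \<open>C\<^sup>1\<close> curve.
\<close>

definition onto_sphere :: "complex \<Rightarrow> real ^ 3" where
  "onto_sphere z = vec3 (cos (2 * pi * Re z) * recip_norm (Im z)) (sin (2 * pi * Re z) * recip_norm (Im z))
     (Im z * recip_norm (Im z))"

text \<open>
  The differential of \<open>onto_sphere\<close> at \<open>z\<close>, applied to \<open>v\<close>.
\<close>

definition onto_sphere' :: "complex \<Rightarrow> complex \<Rightarrow> real ^ 3" where
  "onto_sphere' z v = (let c = cos (2 * pi * Re z); s = sin (2 * pi * Re z); r = recip_norm (Im z);
       r' = - (Im z * Im v * r ^ 3) in
     vec3 (c * r' - 2 * pi * Re v * s * r) (s * r' + 2 * pi * Re v * c * r) (Im z * r' + Im v * r))"

lemma onto_sphere_has_vector_derivative: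
  assumes "(g has_vector_derivative v) (at t within S)"
  shows "((\<lambda>t. onto_sphere (g t)) has_vector_derivative onto_sphere' (g t) v) (at t within S)"
proof -
  have re: "((\<lambda>t. Re (g t)) has_real_derivative Re v) (at t within S)"
    and im: "((\<lambda>t. Im (g t)) has_real_derivative Im v) (at t within S)"
    using assms by (auto simp: has_vector_derivative_complex_iff)
  show ?thesis
    unfolding onto_sphere_def onto_sphere'_def Let_def
    by (intro vec3_has_vector_derivative)
      (auto intro!: derivative_eq_intros assms re im recip_norm_deriv[OF im] simp: algebra_simps)
qed

lemma continuous_on_onto_sphere':
  fixes S :: "real set"
  assumes "continuous_on S g" "continuous_on S v"
  shows "continuous_on S (\<lambda>t. onto_sphere' (g t) (v t))"
proof -
  have "1 + (Im (g t))\<^sup>2 \<noteq> 0" for t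
    by (smt (verit) zero_le_power2)
  moreover have "continuous_on S (\<lambda>t. cos (2 * pi * Re (g t)))" "continuous_on S (\<lambda>t. sin (2 * pi * Re (g t)))"
    by (intro continuous_on_cos continuous_on_sin continuous_intros assms)+
  ultimately show ?thesis
    unfolding onto_sphere'_def Let_def recip_norm_def vec3_def
    using assms by (auto intro!: continuous_intros)
qed

lemma onto_sphere_in_sphere: "onto_sphere z \<in> sphere 0 1"
proof -
  let ?c = "cos (2 * pi * Re z)" and ?s = "sin (2 * pi * Re z)" and ?r = "recip_norm (Im z)"
  have "onto_sphere z \<bullet> onto_sphere z = (?c * ?r)\<^sup>2 + (?s * ?r)\<^sup>2 + (Im z * ?r)\<^sup>2"
    by (simp add: onto_sphere_def inner_vec_def sum_3 power2_eq_square)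
  also have "\<dots> = (?c\<^sup>2 + ?s\<^sup>2) * ?r\<^sup>2 + (Im z)\<^sup>2 * ?r\<^sup>2"
    by (simp only: power_mult_distrib distrib_right)
  also have "\<dots> = ?r\<^sup>2 * (1 + (Im z)\<^sup>2)" by (simp add: algebra_simps)
  finally show ?thesis using recip_norm_sq[of "Im z"] by (simp add: norm_eq_1)
qed

lemma onto_sphere_eq:
  assumes "onto_sphere z = onto_sphere w"
  shows "Im z = Im w" "\<exists>n. Re z = Re w + of_int n"
proof -
  let ?r = "recip_norm (Im z)" and ?q = "recip_norm (Im w)"
  have c: "cos (2 * pi * Re z) * ?r = cos (2 * pi * Re w) * ?q"
    and s: "sin (2 * pi * Re z) * ?r = sin (2 * pi * Re w) * ?q"
    and y: "Im z * ?r = Im w * ?q"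
    using arg_cong[OF assms, of "\<lambda>v. v $ 1"] arg_cong[OF assms, of "\<lambda>v. v $ 2"]
      arg_cong[OF assms, of "\<lambda>v. v $ 3"] by (simp_all add: onto_sphere_def)
  have "(cos (2 * pi * Re z) * ?r)\<^sup>2 + (sin (2 * pi * Re z) * ?r)\<^sup>2
      = (cos (2 * pi * Re w) * ?q)\<^sup>2 + (sin (2 * pi * Re w) * ?q)\<^sup>2" using c s by simp
  then have "?r\<^sup>2 = ?q\<^sup>2"
    by (simp add: power_mult_distrib distrib_right[symmetric])
  then have rq: "?r = ?q" using recip_norm_pos by (simp add: power2_eq_iff_nonneg less_imp_le)
  then show "Im z = Im w" using y recip_norm_pos[of "Im w"] by simp
  have "sin (2 * pi * Re z) = sin (2 * pi * Re w) \<and> cos (2 * pi * Re z) = cos (2 * pi * Re w)"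
    using c s rq recip_norm_pos[of "Im w"] by simp
  then obtain n :: int where "2 * pi * Re z = 2 * pi * Re w + 2 * pi * of_int n"
    unfolding sin_cos_eq_iff by (auto simp: mult.assoc)
  then have "2 * pi * Re z = 2 * pi * (Re w + of_int n)" by (simp add: algebra_simps)
  then have "Re z = Re w + of_int n" by simp
  then show "\<exists>n. Re z = Re w + of_int n" ..
qed

lemma onto_sphere_periodic: "onto_sphere (z + of_int n) = onto_sphere z"
proof -
  have "sin (2 * pi * (Re z + of_int n)) = sin (2 * pi * Re z) \<and> cos (2 * pi * (Re z + of_int n)) = cos (2 * pi * Re z)"
    unfolding sin_cos_eq_iff by (intro exI[of _ n]) (simp add: algebra_simps)
  then show ?thesis by (simp add: onto_sphere_def)
qed

text \<open>
  The differential is injective: the real part of \<open>v\<close> is seen in the horizontal direction tangent to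
  the cylinder, the imaginary part in the third coordinate.  So regularity and transversality carry over
  from the plane to the sphere.
\<close>

lemma onto_sphere'_scale:
  assumes "onto_sphere' z v = l *\<^sub>R onto_sphere' z w"
  shows "v = of_real l * w"
proof -
  let ?c = "cos (2 * pi * Re z)" and ?s = "sin (2 * pi * Re z)" and ?r = "recip_norm (Im z)"
  have third: "onto_sphere' z v $ 3 = Im v * ?r ^ 3" for v
  proof -
    have "onto_sphere' z v $ 3 = Im v * ?r * (1 - (Im z)\<^sup>2 * ?r\<^sup>2)"
      by (simp add: onto_sphere'_def Let_def power2_eq_square power3_eq_cube algebra_simps)
    also have "1 - (Im z)\<^sup>2 * ?r\<^sup>2 = ?r\<^sup>2" using recip_norm_sq[of "Im z"] by (simp add: algebra_simps)
    finally show ?thesis by (simp add: power2_eq_square power3_eq_cube)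
  qed
  have tang: "?c * onto_sphere' z v $ 2 - ?s * onto_sphere' z v $ 1 = 2 * pi * Re v * ?r" for v
  proof -
    have "?c * onto_sphere' z v $ 2 - ?s * onto_sphere' z v $ 1 = 2 * pi * Re v * ?r * (?c\<^sup>2 + ?s\<^sup>2)"
    proof -
      have "c * (s * r' + A * c * r) - s * (c * r' - A * s * r) = A * r * (c\<^sup>2 + s\<^sup>2)" for c s r' A r :: real
        by (simp add: power2_eq_square algebra_simps)
      then show ?thesis unfolding onto_sphere'_def Let_def vec3_nth .
    qed
    then show ?thesis by simp
  qed
  have "Im v * ?r ^ 3 = l * (Im w * ?r ^ 3)" unfolding third[symmetric] assms by simp
  then have "Im v = l * Im w" using recip_norm_pos[of "Im z"] by simp
  moreover have "2 * pi * Re v * ?r = l * (2 * pi * Re w * ?r)"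
    unfolding tang[symmetric] assms by (simp add: algebra_simps)
  then have "Re v = l * Re w" using recip_norm_pos[of "Im z"] by simp
  ultimately show ?thesis by (simp add: complex_eq_iff)
qed

lemma onto_sphere'_nonzero:
  assumes "v \<noteq> 0"
  shows "onto_sphere' z v \<noteq> 0"
  using onto_sphere'_scale[of z v 0 v] assms by auto

definition periodic_extension :: "(real \<Rightarrow> complex) \<Rightarrow> real \<Rightarrow> complex" where
  "periodic_extension g t = g (frac t) + of_int \<lfloor>t\<rfloor>"

text \<open>
  At an integer, two copies of the arc meet; since \<open>g\<close> moves on by \<open>1\<close> with the same velocity at both
  ends, the pieces over adjacent unit intervals fit together.
\<close>

lemma c1_periodic_extension:
  assumes "long_arc g g'"
  shows "(periodic_extension g has_vector_derivative g' (frac t)) (at t)" "isCont (\<lambda>t. g' (frac t)) t"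
proof -
  have c: "c1_on g g' {0..1}" and e: "g 0 = 0" "g 1 = 1" "g' 0 = 5/2" "g' 1 = 5/2"
    using assms by (auto simp: long_arc_def)
  have piece: "c1_on (periodic_extension g) (\<lambda>t. g' (frac t)) {of_int n..of_int (n + 1)}" for n
  proof (rule c1_on_cong)
    show "c1_on (\<lambda>t. of_int n + g (t - of_int n)) (\<lambda>t. g' (t - of_int n)) {of_int n..of_int (n + 1)}"
      using c1_on_affine[OF c, of "{of_int n..of_int (n + 1)}" 1 "- of_int n" "of_int n" 1] by simp
    fix t :: real assume t: "t \<in> {of_int n..of_int (n + 1)}"
    have "periodic_extension g t = of_int n + g (t - of_int n) \<and> g' (frac t) = g' (t - of_int n)"
    proof (cases "t = of_int (n + 1)")
      case True
      then have f: "frac t = 0" "t - of_int n = 1" "\<lfloor>t\<rfloor> = n + 1" by simp_all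
      show ?thesis unfolding periodic_extension_def f by (simp add: e)
    next
      case False
      then have "\<lfloor>t\<rfloor> = n" using t by (auto simp: floor_eq_iff)
      then show ?thesis by (simp add: periodic_extension_def frac_def)
    qed
    then show "periodic_extension g t = of_int n + g (t - of_int n)" "g' (frac t) = g' (t - of_int n)" by auto
  qed
  define n where "n = \<lfloor>t\<rfloor>"
  have "c1_on (periodic_extension g) (\<lambda>t. g' (frac t)) ({of_int (n - 1)..of_int (n - 1 + 1)} \<union> {of_int n..of_int (n + 1)})"
    by (intro c1_on_Un piece) auto
  moreover have "{of_int (n - 1)..of_int (n - 1 + 1)} \<union> {of_int n..of_int (n + 1)} = {of_int n - 1..of_int n + 1 :: real}"
    by auto
  ultimately have *: "c1_on (periodic_extension g) (\<lambda>t. g' (frac t)) {of_int n - 1..of_int n + 1}" by simp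
  have t: "of_int n \<le> t" "t < of_int n + 1" unfolding n_def by linarith+
  have I: "t \<in> interior {of_int n - 1..of_int n + 1}" using t by simp
  have "at t within {of_int n - 1..of_int n + 1} = at t" using I by (rule at_within_interior)
  moreover have "(periodic_extension g has_vector_derivative g' (frac t)) (at t within {of_int n - 1..of_int n + 1})"
    using * t by (auto simp: c1_on_def)
  ultimately show "(periodic_extension g has_vector_derivative g' (frac t)) (at t)" by simp
  show "isCont (\<lambda>t. g' (frac t)) t"
    using * I by (auto simp: c1_on_def intro: continuous_on_interior)
qed

text \<open>
  The integer translation in \<open>periodic_extension\<close> is invisible on the sphere, so it can be dropped here;
  this makes the period \<open>1\<close> evident.
\<close>

definition closed_diagram :: "(real \<Rightarrow> complex) \<Rightarrow> (real \<Rightarrow> bool) \<Rightarrow> diagram" where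
  "closed_diagram g ov = \<lparr>curve = \<lambda>t. onto_sphere (g (frac t)), over = \<lambda>t. ov (frac t)\<rparr>"

lemma curve_closed_diagram: "curve (closed_diagram g ov) = (\<lambda>t. onto_sphere (periodic_extension g t))"
  by (simp add: closed_diagram_def periodic_extension_def onto_sphere_periodic)

lemma curve_derivative:
  assumes "long_arc g g'"
  shows "(curve (closed_diagram g ov) has_vector_derivative onto_sphere' (periodic_extension g t) (g' (frac t))) (at t)"
  unfolding curve_closed_diagram
  by (rule onto_sphere_has_vector_derivative[OF c1_periodic_extension(1)[OF assms]])

text \<open>
  Apart from its end points the arc stays strictly between \<open>Re z = 0\<close> and \<open>Re z = 1\<close>, so closing it up
  creates no new double points.
\<close>

lemma curve_eq_iff_double_times:
  assumes "long_arc g g'" "s \<in> {0..<1}" "t \<in> {0..<1}"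
  shows "s \<noteq> t \<and> curve (closed_diagram g ov) s = curve (closed_diagram g ov) t \<longleftrightarrow> double_times g s t"
proof
  have fr: "frac s = s" "frac t = t" using assms by auto
  assume "s \<noteq> t \<and> curve (closed_diagram g ov) s = curve (closed_diagram g ov) t"
  then have ne: "s \<noteq> t" and eq: "onto_sphere (g s) = onto_sphere (g t)"
    by (auto simp: closed_diagram_def fr)
  have g0: "g 0 = 0" using assms(1) by (simp add: long_arc_def)
  have box: "0 < Re (g u) \<and> Re (g u) < 1" if "u \<in> {0<..<1}" for u
    using assms(1) that by (auto simp: long_arc_def)
  have box': "0 \<le> Re (g u) \<and> Re (g u) < 1" if "u \<in> {0..<1}" for u
    using box[of u] that g0 by (cases "u = 0") auto
  obtain n where n: "Re (g s) = Re (g t) + of_int n" using onto_sphere_eq(2)[OF eq] by blast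
  have "n = 0" using n box'[OF assms(2)] box'[OF assms(3)] by linarith
  then have gst: "g s = g t" using n onto_sphere_eq(1)[OF eq] by (simp add: complex_eq_iff)
  moreover have "s \<noteq> 0"
  proof
    assume "s = 0"
    then have "t \<in> {0<..<1}" using ne assms by auto
    then show False using box[of t] gst g0 \<open>s = 0\<close> by simp
  qed
  moreover have "t \<noteq> 0"
  proof
    assume "t = 0"
    then have "s \<in> {0<..<1}" using ne assms by auto
    then show False using box[of s] gst g0 \<open>t = 0\<close> by simp
  qed
  ultimately show "double_times g s t" using ne assms by (auto simp: double_times_def)
next
  assume "double_times g s t"
  then show "s \<noteq> t \<and> curve (closed_diagram g ov) s = curve (closed_diagram g ov) t"
    using assms by (auto simp: double_times_def closed_diagram_def)
qed

lemma double_times_in: "double_times g s t \<Longrightarrow> s \<in> {0..<1} \<and> t \<in> {0..<1}"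
  by (auto simp: double_times_def)

lemma crossings_closed_diagram:
  assumes "long_arc g g'" "generic_arc g g' ov ts"
  shows "crossings (closed_diagram g ov) = curve (closed_diagram g ov) ` set ts"
proof (intro set_eqI iffI)
  let ?c = "curve (closed_diagram g ov)"
  have ts: "set ts = {t. \<exists>s. double_times g t s}" using assms(2) by (simp add: generic_arc_def)
  show "p \<in> ?c ` set ts" if p: "p \<in> crossings (closed_diagram g ov)" for p
  proof -
    obtain s t where st: "s \<in> {0..<1}" "t \<in> {0..<1}" "s \<noteq> t" "?c s = p" "?c t = p"
      using p unfolding crossings_def by blast
    then have "double_times g s t" using curve_eq_iff_double_times[OF assms(1) st(1,2), of ov] st(3-5) by simp
    then show ?thesis using st(4) unfolding ts by blast
  qed
  show "p \<in> crossings (closed_diagram g ov)" if p: "p \<in> ?c ` set ts" for p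
  proof -
    obtain t s where t: "p = ?c t" "double_times g t s" using p unfolding ts by blast
    then show ?thesis
      using curve_eq_iff_double_times[OF assms(1), of t s ov] double_times_in[OF t(2)] unfolding crossings_def by force
  qed
qed

lemma knot_diagram_closed:
  assumes LA: "long_arc g g'" and GA: "generic_arc g g' ov ts"
  shows "knot_diagram (closed_diagram g ov)"
proof -
  let ?D = "closed_diagram g ov"
  note eqv = curve_eq_iff_double_times[OF LA, of _ _ ov]
  note dv = curve_derivative[OF LA, of ov]
  have vd: "vector_derivative (curve ?D) (at t) = onto_sphere' (periodic_extension g t) (g' (frac t))" for t
    by (rule vector_derivative_at[OF dv])
  have "range (curve ?D) \<subseteq> sphere 0 1"
    unfolding curve_closed_diagram using onto_sphere_in_sphere by blast
  moreover have "\<forall>t. curve ?D (t + 1) = curve ?D t" "\<forall>t. over ?D (t + 1) = over ?D t"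
    by (auto simp: closed_diagram_def frac_1_eq)
  moreover have "curve ?D C1_differentiable_on UNIV"
    unfolding C1_differentiable_on_def
  proof (intro exI conjI ballI)
    show "(curve ?D has_vector_derivative onto_sphere' (periodic_extension g t) (g' (frac t))) (at t)" for t by (rule dv)
    have "continuous_on UNIV (periodic_extension g)"
      using c1_periodic_extension(1)[OF LA] by (auto intro!: continuous_at_imp_continuous_on has_vector_derivative_continuous)
    moreover have "continuous_on UNIV (\<lambda>t. g' (frac t))"
      using c1_periodic_extension(2)[OF LA] by (auto intro!: continuous_at_imp_continuous_on)
    ultimately show "continuous_on UNIV (\<lambda>t. onto_sphere' (periodic_extension g t) (g' (frac t)))"
      by (rule continuous_on_onto_sphere')
  qed
  moreover have "\<forall>t. vector_derivative (curve ?D) (at t) \<noteq> 0"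
  proof
    fix t :: real
    have "frac t \<in> {0..1}" by (simp add: less_imp_le[OF frac_lt_1])
    then have "g' (frac t) \<noteq> 0" using LA unfolding long_arc_def by blast
    then show "vector_derivative (curve ?D) (at t) \<noteq> 0" unfolding vd by (rule onto_sphere'_nonzero)
  qed
  moreover have "finite (crossings ?D)" unfolding crossings_closed_diagram[OF LA GA] by simp
  moreover have "\<forall>s\<in>{0..<1}. \<forall>t\<in>{0..<1}. \<forall>u\<in>{0..<1}.
        curve ?D s = curve ?D t \<and> curve ?D t = curve ?D u \<longrightarrow> s = t \<or> t = u \<or> s = u"
  proof (intro ballI impI)
    fix s t u :: real assume a: "s \<in> {0..<1}" "t \<in> {0..<1}" "u \<in> {0..<1}"
      and eq: "curve ?D s = curve ?D t \<and> curve ?D t = curve ?D u"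
    show "s = t \<or> t = u \<or> s = u"
    proof (rule ccontr)
      assume "\<not> (s = t \<or> t = u \<or> s = u)"
      then have "double_times g t s" "double_times g t u" using eqv[of t s] eqv[of t u] a eq by auto
      then have "s = u" using GA unfolding generic_arc_def by blast
      then show False using \<open>\<not> (s = t \<or> t = u \<or> s = u)\<close> by blast
    qed
  qed
  moreover have "\<forall>s\<in>{0..<1}. \<forall>t\<in>{0..<1}. s \<noteq> t \<and> curve ?D s = curve ?D t \<longrightarrow>
        vector_derivative (curve ?D) (at s) \<notin> span {vector_derivative (curve ?D) (at t)}"
  proof (intro ballI impI notI)
    fix s t :: real assume a: "s \<in> {0..<1}" "t \<in> {0..<1}" "s \<noteq> t \<and> curve ?D s = curve ?D t"
      and "vector_derivative (curve ?D) (at s) \<in> span {vector_derivative (curve ?D) (at t)}"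
    then obtain l where l: "onto_sphere' (periodic_extension g s) (g' (frac s)) = l *\<^sub>R onto_sphere' (periodic_extension g t) (g' (frac t))"
      unfolding vd span_singleton by blast
    have d: "double_times g s t" using eqv a by blast
    have fr: "frac s = s" "frac t = t" "\<lfloor>s\<rfloor> = 0" "\<lfloor>t\<rfloor> = 0" using a by (auto simp: floor_eq_iff)
    have "periodic_extension g s = periodic_extension g t" using d by (simp add: periodic_extension_def fr double_times_def)
    then have "g' s = of_real l * g' t" using onto_sphere'_scale l fr by metis
    then have "Im (cnj (g' s) * g' t) = 0" by (simp add: algebra_simps)
    then show False using GA d unfolding generic_arc_def by blast
  qed
  moreover have "\<forall>s\<in>{0..<1}. \<forall>t\<in>{0..<1}. s \<noteq> t \<and> curve ?D s = curve ?D t \<longrightarrow> over ?D s \<noteq> over ?D t"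
  proof (intro ballI impI)
    fix s t :: real assume a: "s \<in> {0..<1}" "t \<in> {0..<1}" "s \<noteq> t \<and> curve ?D s = curve ?D t"
    then have "double_times g s t" using eqv by blast
    then have "ov s \<noteq> ov t" using GA unfolding generic_arc_def by blast
    then show "over ?D s \<noteq> over ?D t" using a by (simp add: closed_diagram_def)
  qed
  ultimately show ?thesis unfolding knot_diagram_def by blast
qed

text \<open>
  The base point is the image of the start \<open>0\<close> of the arc.  One turn from there runs once through the
  arc, so the crossing times are those of the arc, and the start level is the number of crossings that are
  first met from below.
\<close>

lemma realizable_diagram:
  assumes "realizable w k"
  shows "\<exists>D. knot_diagram D \<and> warping_polynomial D = (if w = [] then 1 else walk_poly k w)"
proof -
  from assms obtain g g' ov ts where LA: "long_arc g g'" and GA: "generic_arc g g' ov ts"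
    and w: "map ov ts = w" and k: "card (under_first g ov) = k"
    unfolding realizable_def by blast
  let ?D = "closed_diagram g ov"
  have K: "knot_diagram ?D" by (rule knot_diagram_closed[OF LA GA])
  interpret knot ?D by (rule knot.intro[OF K])
  have X: "crossings ?D = c ` set ts" by (rule crossings_closed_diagram[OF LA GA])
  note eqv = curve_eq_iff_double_times[OF LA, of _ _ ov]
  have ts: "set ts = {t. \<exists>s. double_times g t s}" "sorted_wrt (<) ts" using GA by (auto simp: generic_arc_def)
  have ts_in: "t \<in> {0<..<1}" if "t \<in> set ts" for t using that unfolding ts by (auto simp: double_times_def)
  have at: "at_crossing t \<longleftrightarrow> t \<in> set ts" if t: "t \<in> {0..<1}" for t
  proof
    assume "at_crossing t"
    then obtain s where s: "s \<in> set ts" "c t = c s" unfolding at_crossing_def X by blast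
    show "t \<in> set ts"
    proof (cases "t = s")
      case False
      have "s \<in> {0..<1}" using ts_in[OF s(1)] by simp
      then have "double_times g t s" using eqv[OF t, of s] False s(2) by blast
      then show ?thesis unfolding ts by blast
    qed (use s in simp)
  qed (simp add: at_crossing_def X)
  have nc: "\<not> at_crossing 0" using at[of 0] ts_in[of 0] by auto
  have ta: "set ts = times_after 0"
    unfolding times_after_def using at ts_in by force
  have uf: "{p. first_under 0 p} = c ` under_first g ov"
  proof (intro set_eqI iffI)
    fix p assume "p \<in> {p. first_under 0 p}"
    then obtain s t where st: "0 < s" "s < t" "t < 0 + 1" "c s = p" "c t = p" "\<not> over ?D s"
      unfolding first_under_def by blast
    then have "double_times g s t" using eqv[of s t] by auto
    moreover have "\<not> ov s" using st by (simp add: closed_diagram_def)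
    ultimately show "p \<in> c ` under_first g ov" using st unfolding under_first_def by blast
  next
    fix p assume "p \<in> c ` under_first g ov"
    then obtain s t where st: "p = c s" "\<not> ov s" "s < t" "double_times g s t" unfolding under_first_def by blast
    then have "0 < s" "t < 1" "c s = c t" using eqv[of s t] double_times_in[OF st(4)] by (auto simp: double_times_def)
    moreover have "\<not> over ?D s" using st double_times_in[OF st(4)] by (simp add: closed_diagram_def)
    ultimately show "p \<in> {p. first_under 0 p}" using st unfolding first_under_def by auto
  qed
  have inj: "inj_on c (under_first g ov)"
  proof (rule inj_onI, rule ccontr)
    fix s s' assume a: "s \<in> under_first g ov" "s' \<in> under_first g ov" "c s = c s'" "s \<noteq> s'"
    then obtain t t' where t: "s < t" "double_times g s t" "s' < t'" "double_times g s' t'"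
      unfolding under_first_def by blast
    have d: "double_times g s s'" using eqv[of s s'] a double_times_in[OF t(2)] double_times_in[OF t(4)] by blast
    then have "double_times g s' s" by (simp add: double_times_sym)
    then have "t = s'" "t' = s" using GA d t unfolding generic_arc_def by blast+
    then show False using t by simp
  qed
  have deg: "degree_at 0 = k"
    unfolding degree_at_eq[OF nc] uf card_image[OF inj] k ..
  show ?thesis
  proof (cases "w = []")
    case True
    then have "crossings ?D = {}" using X w by simp
    then show ?thesis using warping_polynomial_no_crossings K True by auto
  next
    case False
    then have "crossings ?D \<noteq> {}" using X w by auto
    moreover have "map (over ?D) ts = w"
    proof -
      have "frac t = t" if "t \<in> set ts" for t using ts_in[OF that] by (intro frac_eq_id) auto
      then show ?thesis unfolding w[symmetric] by (simp add: closed_diagram_def)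
    qed
    ultimately have "warping_polynomial ?D = walk_poly k w"
      using warping_polynomial_walk(3)[OF nc _ ts(2) ta] deg by simp
    then show ?thesis using K False by auto
  qed
qed

section \<open>Diagrams with prescribed warping polynomial\<close>

lemma realizable_kinks: "realizable (kinks b n) (if b then 0 else n)"
proof (induction n)
  case (Suc n)
  from realizable_append[OF realizable_wrap[OF realizable_Nil, of b] Suc.IH] show ?case
    by (cases b) auto
qed (simp add: realizable_Nil)

text \<open>
  Only the kinks that are passed first from below have warping crossings; every large loop is passed
  first from above.
\<close>

lemma realizable_nest: "realizable (nest ps) (sum_list (map snd ps))"
proof (induction ps rule: nest.induct)
  case (2 p q ps)
  from realizable_append[OF realizable_kinks[of True p]
      realizable_wrap[OF realizable_append[OF realizable_kinks[of False q] 2], of True]]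
  show ?case by simp
qed (simp add: realizable_Nil)

theorem theorem1p1:
  fixes f :: "int poly"
  shows "(\<exists>D. knot_diagram D \<and> warping_polynomial D = f) \<longleftrightarrow>
    f = 1 \<or>
    (\<exists>(k::nat) (l::nat) (m::nat \<Rightarrow> int).
       l \<ge> 1 \<and> (\<forall>i<l. m i \<ge> 1) \<and> (\<Sum>i<l. m i) \<ge> int k + int l \<and>
       f = monom (m 0) k
           + (\<Sum>i=1..<l. monom (m (i - 1) + m i) (k + i))
           + monom (m (l - 1)) (k + l))"
proof
  assume "\<exists>D. knot_diagram D \<and> warping_polynomial D = f"
  then obtain D where D: "knot_diagram D" "warping_polynomial D = f" by blast
  from knot.warping_polynomial_shape[OF knot.intro[OF D(1)]]
  show "f = 1 \<or>
    (\<exists>(k::nat) (l::nat) (m::nat \<Rightarrow> int).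
       l \<ge> 1 \<and> (\<forall>i<l. m i \<ge> 1) \<and> (\<Sum>i<l. m i) \<ge> int k + int l \<and>
       f = monom (m 0) k
           + (\<Sum>i=1..<l. monom (m (i - 1) + m i) (k + i))
           + monom (m (l - 1)) (k + l))"
    unfolding D(2)
  proof (elim disjE exE conjE)
    fix k l :: nat and m :: "nat \<Rightarrow> int"
    assume a: "l \<ge> 1" "\<forall>i<l. m i \<ge> 1" "(\<Sum>i<l. m i) \<ge> int k + int l"
      "f = (\<Sum>i<l. monom (m i) (k + i) + monom (m i) (k + i + 1))"
    show ?thesis
      by (intro disjI2 exI[of _ k] exI[of _ l] exI[of _ m] conjI a(1-3))
        (simp only: a(4) level_polynomial_pairs[OF a(1)])
  qed (rule disjI1)
next
  assume "f = 1 \<or>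
    (\<exists>(k::nat) (l::nat) (m::nat \<Rightarrow> int).
       l \<ge> 1 \<and> (\<forall>i<l. m i \<ge> 1) \<and> (\<Sum>i<l. m i) \<ge> int k + int l \<and>
       f = monom (m 0) k
           + (\<Sum>i=1..<l. monom (m (i - 1) + m i) (k + i))
           + monom (m (l - 1)) (k + l))"
  then show "\<exists>D. knot_diagram D \<and> warping_polynomial D = f"
  proof (elim disjE exE conjE)
    assume "f = 1"
    then show ?thesis using realizable_diagram[OF realizable_Nil] by simp
  next
    fix k l :: nat and m :: "nat \<Rightarrow> int"
    assume l: "l \<ge> 1" and m: "\<forall>i<l. m i \<ge> 1" "(\<Sum>i<l. m i) \<ge> int k + int l"
      and f: "f = monom (m 0) k
           + (\<Sum>i=1..<l. monom (m (i - 1) + m i) (k + i))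
           + monom (m (l - 1)) (k + l)"
    obtain q where q: "\<forall>i<l. int (q i) + 1 \<le> m i" "(\<Sum>i<l. q i) = k"
      using bounded_split[OF m] by blast
    \<comment> \<open>The kinks at gap \<open>i\<close> number \<open>m i - 1\<close>: the large loop provides the remaining step up.\<close>
    define ps where "ps = map (\<lambda>i. (nat (m i - 1 - int (q i)), q i)) [0..<l]"
    have len: "length ps = l" by (simp add: ps_def)
    have count: "int (fst (ps ! i) + snd (ps ! i) + 1) = m i" if "i < l" for i
      using q(1)[rule_format, OF that] that by (simp add: ps_def)
    have "sum_list (map snd ps) = k"
      using q(2) by (simp add: ps_def o_def interv_sum_list_conv_sum_set_nat atLeast0LessThan)
    then have real: "realizable (nest ps) k" using realizable_nest[of ps] by simp
    have "nest ps \<noteq> []" using l len by (cases ps rule: nest.cases) auto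
    with realizable_diagram[OF real] obtain D where D: "knot_diagram D" "warping_polynomial D = walk_poly k (nest ps)"
      by auto
    have "walk_poly k (nest ps) = (\<Sum>i<l. monom (m i) (k + i) + monom (m i) (k + i + 1))"
      unfolding walk_poly_nest len by (rule sum.cong[OF refl]) (simp only: count lessThan_iff)
    also have "\<dots> = f" unfolding f level_polynomial_pairs[OF l] ..
    finally show ?thesis using D by blast
  qed
qed

end
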